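(* Let $\{(x^{k},y^{k},z^{k})\}$ be a sequence generated by the IEIDP-ADMM with criterion (C2) (both defined in the context), where $\max(\mu_{k},\nu_{k})\le\min\big(0.1,\frac{2-\tau}{4}\big)$ for all $k\ge 1$. Suppose that Assumption A (see the context) holds and that, in addition to $\mathcal{T}_f\succ 0$ and $\mathcal{T}_g\succ 0$, the operators $\mathcal{P}_f$ and $\mathcal{P}_g$ satisfy $\mathcal{P}_f+\frac{3}{8}\Sigma_f\succeq 0$ and $\mathcal{P}_g+\frac{3}{8}\Sigma_g\succeq 0$. Suppose that either (a) $\tau\in\big(0,\frac{1+\sqrt5}{2}\big)$, or (b) $\tau\in\big[\frac{1+\sqrt5}{2},2\big)$ and $\sum_{k=0}^{\infty}\Big(\frac{10\sigma}{\tau}\|h(x^{k},y^{k})\|^2+\|y^{k+1}-y^k\|^2_{\mathcal{T}_g}\Big)<\infty$. Then the sequence $\{(x^{k},y^{k})\}$ converges to an optimal solution of problem (P), and the sequence $\{z^{k}\}$ converges to an optimal solution of the dual problem of (P).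
   Context: Setting. $\mathbb{X},\mathbb{Y},\mathbb{Z}$ are finite-dimensional real vector spaces with inner product $\langle\cdot,\cdot\rangle$ and induced norm $\|\cdot\|$; $f:\mathbb{X}\to(-\infty,+\infty]$ and $g:\mathbb{Y}\to(-\infty,+\infty]$ are closed proper convex functions; $\mathcal{A}:\mathbb{Z}\to\mathbb{X}$, $\mathcal{B}:\mathbb{Z}\to\mathbb{Y}$ are linear operators with adjoints $\mathcal{A}^*,\mathcal{B}^*$; $c\in\mathbb{Z}$. Problem (P): $\min_{x\in\mathbb{X},y\in\mathbb{Y}} f(x)+g(y)$ subject to $\mathcal{A}^*x+\mathcal{B}^*y=c$. Its dual is the Lagrangian dual $\max_{z\in\mathbb{Z}}\ -f^*(-\mathcal{A}z)-g^*(-\mathcal{B}z)-\langle c,z\rangle$, with $f^*,g^*$ the convex conjugates. Write $h(x,y):=\mathcal{A}^*x+\mathcal{B}^*y-c$. Notation. For self-adjoint $\mathcal{T}$, $\mathcal{T}\succeq0$ ($\succ0$) means positive semidefinite (definite), $\mathcal{S}\preceq\mathcal{T}$ means $\mathcal{T}-\mathcal{S}\succeq0$, and $\|x\|_{\mathcal{T}}^2:=\langle x,\mathcal{T}x\rangle$ (this expression is used also for indefinite $\mathcal{T}$); for $\mathcal{T}\succeq 0$, $\|x\|_{\mathcal{T}}:=\sqrt{\langle x,\mathcal{T}x\rangle}$. For $\mathcal{T}\succ0$, $D_{\mathcal{T}}(x,\Omega):=\min_{u\in\Omega}\|u-x\|_{\mathcal{T}}$ is the distance to a nonempty closed set $\Omega$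 (conditions on $D_{\mathcal{T}}(0,\partial\phi)$ include nonemptiness of the subdifferential). $\partial$ denotes the convex subdifferential of the function. Operators $\Sigma_f,\Sigma_g$. $\Sigma_f\succeq0$ on $\mathbb{X}$ and $\Sigma_g\succeq0$ on $\mathbb{Y}$ are fixed self-adjoint operators such that for all $x,\tilde x\in\mathrm{dom} f$, $u\in\partial f(x)$, $\tilde u\in\partial f(\tilde x)$: $f(x)\ge f(\tilde x)+\langle\tilde u,x-\tilde x\rangle+\frac12\|x-\tilde x\|^2_{\Sigma_f}$ and $\langle u-\tilde u,x-\tilde x\rangle\ge\|x-\tilde x\|^2_{\Sigma_f}$; and for all $y,\tilde y\in\mathrm{dom} g$, $v\in\partial g(y)$, $\tilde v\in\partial g(\tilde y)$: $g(y)\ge g(\tilde y)+\langle\tilde v,y-\tilde y\rangle+\frac12\|y-\tilde y\|^2_{\Sigma_g}$ and $\langle v-\tilde v,y-\tilde y\rangle\ge\|y-\tilde y\|^2_{\Sigma_g}$. Assumption A. Problem (P) has an optimal solution $(x^*,y^* )\in\mathrm{dom} f\times\mathrm{dom} g$, and there is $(\hat x,\hat y)\in\mathrm{ri}(\mathrm{dom} f\times\mathrm{dom} g)$ with $\mathcal{A}^*\hat x+\mathcal{B}^*\hat y=c$. Algorithm (IEIDP-ADMM). Let $\sigma,\tau>0$, and let $L_\sigma(x,y,z):=f(x)+g(y)+\langle z,\mathcal{A}^*x+\mathcal{B}^*y-c\rangle+\frac{\sigma}{2}\|\mathcal{A}^*x+\mathcal{B}^*y-c\|^2$. Choose self-adjoint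 (possibly indefinite) operators $\mathcal{P}_f:\mathbb{X}\to\mathbb{X}$, $\mathcal{P}_g:\mathbb{Y}\to\mathbb{Y}$ with $\mathcal{T}_f:=\mathcal{P}_f+\Sigma_f+\sigma\mathcal{A}\mathcal{A}^*\succ0$ and $\mathcal{T}_g:=\mathcal{P}_g+\Sigma_g+\sigma\mathcal{B}\mathcal{B}^*\succ0$, and $(x^0,y^0,z^0)\in\mathrm{dom} f\times\mathrm{dom} g\times\mathbb{Z}$. For $k=0,1,2,\dots$: $x^{k+1}$ is an approximate minimizer of $\phi_k(x):=L_\sigma(x,y^k,z^k)+\frac12\|x-x^k\|^2_{\mathcal{P}_f}$; $y^{k+1}$ is an approximate minimizer of $\psi_k(y):=L_\sigma(x^{k+1},y,z^k)+\frac12\|y-y^k\|^2_{\mathcal{P}_g}$; and $z^{k+1}=z^k+\tau\sigma(\mathcal{A}^*x^{k+1}+\mathcal{B}^*y^{k+1}-c)$. Criterion (C2). With nonnegative sequences $\{\mu_k\}_{k\ge1},\{\nu_k\}_{k\ge1}$ and self-adjoint positive definite operators $\mathcal{F}:\mathbb{X}\to\mathbb{X}$, $\mathcal{G}:\mathbb{Y}\to\mathbb{Y}$ satisfying $\mathcal{F}^{-1}\preceq\mathcal{T}_f$, $\mathcal{G}^{-1}\preceq\mathcal{T}_g$: for all $k\ge0$, $D_{\mathcal{F}}(0,\partial\phi_k(x^{k+1}))\le\mu_{k+1}\|x^{k+1}-x^k\|_{\mathcal{T}_f}$ and $D_{\mathcal{G}}(0,\partial\psi_k(y^{k+1}))\le\nu_{k+1}\|y^{k+1}-y^k\|_{\mathcal{T}_g}$,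 and $\sum_{k=0}^\infty\max(\mu_{k+1},\nu_{k+1})<\infty$. *)

theory Defs
  imports "HOL-Analysis.Analysis"
begin

section \<open>Self-adjoint operators and the seminorms they induce\<close>

definition self_adjoint :: "('a::real_inner \<Rightarrow> 'a) \<Rightarrow> bool" where
  "self_adjoint T \<longleftrightarrow> linear T \<and> (\<forall>u v. T u \<bullet> v = u \<bullet> T v)"

definition psd :: "('a::real_inner \<Rightarrow> 'a) \<Rightarrow> bool" where
  "psd T \<longleftrightarrow> self_adjoint T \<and> (\<forall>u. 0 \<le> u \<bullet> T u)"

definition pd :: "('a::real_inner \<Rightarrow> 'a) \<Rightarrow> bool" where
  "pd T \<longleftrightarrow> self_adjoint T \<and> (\<forall>u. u \<noteq> 0 \<longrightarrow> 0 < u \<bullet> T u)"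

definition loewner_le :: "('a::real_inner \<Rightarrow> 'a) \<Rightarrow> ('a \<Rightarrow> 'a) \<Rightarrow> bool" where
  "loewner_le S T \<longleftrightarrow> psd (\<lambda>u. T u - S u)"

text \<open>The square is also used for indefinite \<open>T\<close>, where it may be negative, so it is not defined
  as the square of \<open>norm_op\<close>.\<close>

definition sqnorm_op :: "('a::real_inner \<Rightarrow> 'a) \<Rightarrow> 'a \<Rightarrow> real" where
  "sqnorm_op T u = u \<bullet> T u"

definition norm_op :: "('a::real_inner \<Rightarrow> 'a) \<Rightarrow> 'a \<Rightarrow> real" where
  "norm_op T u = sqrt (u \<bullet> T u)"

text \<open>For a positive definite \<open>T\<close> and a nonempty closed \<open>\<Omega>\<close> in finite dimension the infimum is
  attained. For \<open>\<Omega> = {}\<close> the real infimum is a junk value, so nonemptiness has to be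
  required separately.\<close>

definition dist_op :: "('a::real_inner \<Rightarrow> 'a) \<Rightarrow> 'a \<Rightarrow> 'a set \<Rightarrow> real" where
  "dist_op T u \<Omega> = (INF v\<in>\<Omega>. norm_op T (v - u))"


section \<open>Extended-real-valued convex functions\<close>

definition edom :: "('a \<Rightarrow> ereal) \<Rightarrow> 'a set" where
  "edom f = {u. f u < \<infinity>}"

definition eepigraph :: "('a \<Rightarrow> ereal) \<Rightarrow> ('a \<times> real) set" where
  "eepigraph f = {(u, r). f u \<le> ereal r}"

definition closed_proper_convex :: "('a::euclidean_space \<Rightarrow> ereal) \<Rightarrow> bool" where
  "closed_proper_convex f \<longleftrightarrow>
     (\<forall>u. f u \<noteq> -\<infinity>) \<and> edom f \<noteq> {} \<and> convex (eepigraph f) \<and> closed (eepigraph f)"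

text \<open>For a proper \<open>f\<close> this is empty outside \<open>edom f\<close>.\<close>

definition subdiff :: "('a::real_inner \<Rightarrow> ereal) \<Rightarrow> 'a \<Rightarrow> 'a set" where
  "subdiff f u = {s. \<forall>v. f u + ereal (s \<bullet> (v - u)) \<le> f v}"

definition conjugate :: "('a::real_inner \<Rightarrow> ereal) \<Rightarrow> 'a \<Rightarrow> ereal" where
  "conjugate f s = (SUP u. ereal (s \<bullet> u) - f u)"

definition convexity_operator :: "('a::real_inner \<Rightarrow> ereal) \<Rightarrow> ('a \<Rightarrow> 'a) \<Rightarrow> bool" where
  "convexity_operator f S \<longleftrightarrow> psd S \<and>
     (\<forall>u\<in>edom f. \<forall>u'\<in>edom f. \<forall>s\<in>subdiff f u. \<forall>s'\<in>subdiff f u'.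
        f u' + ereal (s' \<bullet> (u - u') + 1/2 * sqnorm_op S (u - u')) \<le> f u \<and>
        sqnorm_op S (u - u') \<le> (s - s') \<bullet> (u - u'))"


section \<open>The primal and the dual problem\<close>

definition residual ::
  "('z::euclidean_space \<Rightarrow> 'x::euclidean_space) \<Rightarrow> ('z \<Rightarrow> 'y::euclidean_space) \<Rightarrow> 'z \<Rightarrow> 'x \<Rightarrow> 'y \<Rightarrow> 'z"
  where "residual A B c x y = adjoint A x + adjoint B y - c"

definition primal_solution ::
  "('x::euclidean_space \<Rightarrow> ereal) \<Rightarrow> ('y::euclidean_space \<Rightarrow> ereal) \<Rightarrow>
   ('z::euclidean_space \<Rightarrow> 'x) \<Rightarrow> ('z \<Rightarrow> 'y) \<Rightarrow> 'z \<Rightarrow> 'x \<Rightarrow> 'y \<Rightarrow> bool"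
  where "primal_solution f g A B c x y \<longleftrightarrow>
     x \<in> edom f \<and> y \<in> edom g \<and> adjoint A x + adjoint B y = c \<and>
     (\<forall>x' y'. adjoint A x' + adjoint B y' = c \<longrightarrow> f x + g y \<le> f x' + g y')"

definition dual_objective ::
  "('x::euclidean_space \<Rightarrow> ereal) \<Rightarrow> ('y::euclidean_space \<Rightarrow> ereal) \<Rightarrow>
   ('z::euclidean_space \<Rightarrow> 'x) \<Rightarrow> ('z \<Rightarrow> 'y) \<Rightarrow> 'z \<Rightarrow> 'z \<Rightarrow> ereal"
  where "dual_objective f g A B c z =
     - conjugate f (- A z) - conjugate g (- B z) - ereal (c \<bullet> z)"

text \<open>A dual solution is required to be dual feasible, i.e. to have a dual value different
  from \<open>-\<infinity>\<close>.\<close>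

definition dual_solution ::
  "('x::euclidean_space \<Rightarrow> ereal) \<Rightarrow> ('y::euclidean_space \<Rightarrow> ereal) \<Rightarrow>
   ('z::euclidean_space \<Rightarrow> 'x) \<Rightarrow> ('z \<Rightarrow> 'y) \<Rightarrow> 'z \<Rightarrow> 'z \<Rightarrow> bool"
  where "dual_solution f g A B c z \<longleftrightarrow>
     dual_objective f g A B c z \<noteq> -\<infinity> \<and>
     (\<forall>z'. dual_objective f g A B c z' \<le> dual_objective f g A B c z)"

definition assumption_A ::
  "('x::euclidean_space \<Rightarrow> ereal) \<Rightarrow> ('y::euclidean_space \<Rightarrow> ereal) \<Rightarrow>
   ('z::euclidean_space \<Rightarrow> 'x) \<Rightarrow> ('z \<Rightarrow> 'y) \<Rightarrow> 'z \<Rightarrow> bool"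
  where "assumption_A f g A B c \<longleftrightarrow>
     (\<exists>x y. primal_solution f g A B c x y) \<and>
     (\<exists>x y. (x, y) \<in> rel_interior (edom f \<times> edom g) \<and> adjoint A x + adjoint B y = c)"


section \<open>The inexact ADMM\<close>

definition aug_lagrangian ::
  "('x::euclidean_space \<Rightarrow> ereal) \<Rightarrow> ('y::euclidean_space \<Rightarrow> ereal) \<Rightarrow>
   ('z::euclidean_space \<Rightarrow> 'x) \<Rightarrow> ('z \<Rightarrow> 'y) \<Rightarrow> 'z \<Rightarrow> real \<Rightarrow> 'x \<Rightarrow> 'y \<Rightarrow> 'z \<Rightarrow> ereal"
  where "aug_lagrangian f g A B c \<sigma> x y z =
     f x + g y + ereal (z \<bullet> (adjoint A x + adjoint B y - c)
                        + \<sigma> / 2 * (norm (adjoint A x + adjoint B y - c))\<^sup>2)"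

text \<open>\<open>T_op \<sigma> A P S\<close> is the operator \<open>P + S + \<sigma> A A\<^sup>*\<close>; it serves for both blocks.\<close>

definition T_op ::
  "real \<Rightarrow> ('z::euclidean_space \<Rightarrow> 'a::euclidean_space) \<Rightarrow> ('a \<Rightarrow> 'a) \<Rightarrow> ('a \<Rightarrow> 'a) \<Rightarrow> 'a \<Rightarrow> 'a"
  where "T_op \<sigma> A P S = (\<lambda>u. P u + S u + \<sigma> *\<^sub>R A (adjoint A u))"

text \<open>The functions minimised in the two block updates; \<open>xk\<close> and \<open>yk\<close> are the proximal centres.
  For the y-update, \<open>x'\<close> is the freshly computed first block.\<close>

definition x_subproblem ::
  "('x::euclidean_space \<Rightarrow> ereal) \<Rightarrow> ('y::euclidean_space \<Rightarrow> ereal) \<Rightarrow>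
   ('z::euclidean_space \<Rightarrow> 'x) \<Rightarrow> ('z \<Rightarrow> 'y) \<Rightarrow> 'z \<Rightarrow> real \<Rightarrow> ('x \<Rightarrow> 'x) \<Rightarrow>
   'x \<Rightarrow> 'y \<Rightarrow> 'z \<Rightarrow> 'x \<Rightarrow> ereal"
  where "x_subproblem f g A B c \<sigma> Pf xk yk zk = (\<lambda>x.
     aug_lagrangian f g A B c \<sigma> x yk zk + ereal (1/2 * sqnorm_op Pf (x - xk)))"

definition y_subproblem ::
  "('x::euclidean_space \<Rightarrow> ereal) \<Rightarrow> ('y::euclidean_space \<Rightarrow> ereal) \<Rightarrow>
   ('z::euclidean_space \<Rightarrow> 'x) \<Rightarrow> ('z \<Rightarrow> 'y) \<Rightarrow> 'z \<Rightarrow> real \<Rightarrow> ('y \<Rightarrow> 'y) \<Rightarrow>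
   'x \<Rightarrow> 'y \<Rightarrow> 'z \<Rightarrow> 'y \<Rightarrow> ereal"
  where "y_subproblem f g A B c \<sigma> Pg x' yk zk = (\<lambda>y.
     aug_lagrangian f g A B c \<sigma> x' y zk + ereal (1/2 * sqnorm_op Pg (y - yk)))"

text \<open>Relative-error criterion for one approximate minimisation of \<open>\<phi>\<close>, moving from \<open>u\<close> to
  \<open>u'\<close>.\<close>

definition approx_minimizer ::
  "('a::real_inner \<Rightarrow> 'a) \<Rightarrow> ('a \<Rightarrow> 'a) \<Rightarrow> real \<Rightarrow> ('a \<Rightarrow> ereal) \<Rightarrow> 'a \<Rightarrow> 'a \<Rightarrow> bool"
  where "approx_minimizer F T \<mu> \<phi> u u' \<longleftrightarrow>
     subdiff \<phi> u' \<noteq> {} \<and> dist_op F 0 (subdiff \<phi> u') \<le> \<mu> * norm_op T (u' - u)"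

text \<open>The tolerances are indexed from 1; \<open>\<mu> 0\<close> and \<open>\<nu> 0\<close> are irrelevant. A positive definite
  operator in finite dimension is bijective, so \<open>inv F\<close> is its inverse.\<close>

definition IEIDP_ADMM_C2 ::
  "('x::euclidean_space \<Rightarrow> ereal) \<Rightarrow> ('y::euclidean_space \<Rightarrow> ereal) \<Rightarrow>
   ('z::euclidean_space \<Rightarrow> 'x) \<Rightarrow> ('z \<Rightarrow> 'y) \<Rightarrow> 'z \<Rightarrow> real \<Rightarrow> real \<Rightarrow>
   ('x \<Rightarrow> 'x) \<Rightarrow> ('y \<Rightarrow> 'y) \<Rightarrow> ('x \<Rightarrow> 'x) \<Rightarrow> ('y \<Rightarrow> 'y) \<Rightarrow> ('x \<Rightarrow> 'x) \<Rightarrow> ('y \<Rightarrow> 'y) \<Rightarrow>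
   (nat \<Rightarrow> real) \<Rightarrow> (nat \<Rightarrow> real) \<Rightarrow> (nat \<Rightarrow> 'x) \<Rightarrow> (nat \<Rightarrow> 'y) \<Rightarrow> (nat \<Rightarrow> 'z) \<Rightarrow> bool"
  where "IEIDP_ADMM_C2 f g A B c \<sigma> \<tau> \<Sigma>f \<Sigma>g Pf Pg F G \<mu> \<nu> x y z \<longleftrightarrow>
     0 < \<sigma> \<and> 0 < \<tau> \<and>
     self_adjoint Pf \<and> self_adjoint Pg \<and>
     pd (T_op \<sigma> A Pf \<Sigma>f) \<and> pd (T_op \<sigma> B Pg \<Sigma>g) \<and>
     pd F \<and> pd G \<and>
     loewner_le (inv F) (T_op \<sigma> A Pf \<Sigma>f) \<and> loewner_le (inv G) (T_op \<sigma> B Pg \<Sigma>g) \<and>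
     (\<forall>k\<ge>1. 0 \<le> \<mu> k \<and> 0 \<le> \<nu> k) \<and>
     summable (\<lambda>k. max (\<mu> (Suc k)) (\<nu> (Suc k))) \<and>
     x 0 \<in> edom f \<and> y 0 \<in> edom g \<and>
     (\<forall>k.
        approx_minimizer F (T_op \<sigma> A Pf \<Sigma>f) (\<mu> (Suc k))
          (x_subproblem f g A B c \<sigma> Pf (x k) (y k) (z k)) (x k) (x (Suc k)) \<and>
        approx_minimizer G (T_op \<sigma> B Pg \<Sigma>g) (\<nu> (Suc k))
          (y_subproblem f g A B c \<sigma> Pg (x (Suc k)) (y k) (z k)) (y k) (y (Suc k)) \<and>
        z (Suc k) = z k + (\<tau> * \<sigma>) *\<^sub>R (adjoint A (x (Suc k)) + adjoint B (y (Suc k)) - c))"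

end

theory Submission
  imports Defs
begin

text \<open>
  The squared distance of the iterates to a KKT point, in a metric adapted to the iteration and
  augmented by terms that measure the last step, would be nonincreasing if the subproblems were
  solved exactly; inexactness and, for large \<open>\<tau>\<close>, a cross term perturb this only summably.

  A KKT point exists by separation in finite dimension (\<open>kkt_point_exists\<close>), and its components
  solve the primal and the dual problem, so it suffices to show convergence to some KKT point.

  By \<open>block_update_subgradient\<close> an inexact block update is an exact optimality condition for
  \<open>f\<close> or \<open>g\<close> with an additional error vector of small relative norm. Inserting these
  conditions into the strong monotonicity of the subdifferentials yields \<open>merit_step\<close>: the squared
  distance \<open>merit\<close> decreases by a multiple of the squared step, up to the error terms and one
  cross term between the y-step and the residual. The indefinite parts of the proximal operators
  are compensated by the monotonicity moduli \<open>\<Sigma>f\<close>, \<open>\<Sigma>g\<close>, for which the lower bounds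
  \<open>-3/8 \<Sigma>f\<close> and \<open>-3/8 \<Sigma>g\<close> suffice. For \<open>\<tau>\<close> below the golden ratio the cross term is
  handled by comparing two successive y-updates (\<open>consecutive_y_steps\<close>), which adds
  quadratic terms in the residual and in the last y-step to the potential; for larger \<open>\<tau>\<close> it is summable by
  hypothesis.

  The error terms are at most \<open>\<epsilon> k\<close> times the new potential plus the last two squared steps
  (\<open>error_terms_le\<close>). As \<open>\<epsilon>\<close> is summable, \<open>perturbed_descent_convergence\<close> shows that
  \<open>merit\<close> converges for every KKT point and that the steps and residuals tend to 0. The
  iterates are then bounded, a cluster point satisfies the KKT conditions by closedness of the
  subdifferential graphs, and its own merit function must tend to 0
  (\<open>inexact_iterates_converge\<close>).
\<close>

section \<open>Quadratic forms of self-adjoint operators\<close>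

lemma self_adjoint_linear: "self_adjoint T \<Longrightarrow> linear T"
  by (simp add: self_adjoint_def)

lemma self_adjoint_swap: "self_adjoint T \<Longrightarrow> T u \<bullet> v = u \<bullet> T v"
  by (simp add: self_adjoint_def)

lemma psd_self_adjoint: "psd T \<Longrightarrow> self_adjoint T"
  by (simp add: psd_def)

lemma pd_self_adjoint: "pd T \<Longrightarrow> self_adjoint T"
  by (simp add: pd_def)

lemma psd_sqnorm_nonneg: "psd T \<Longrightarrow> 0 \<le> sqnorm_op T u"
  by (simp add: psd_def sqnorm_op_def)

lemma pd_imp_psd: "pd T \<Longrightarrow> psd T"
  unfolding pd_def psd_def by (metis inner_zero_left less_eq_real_def)

lemma sqnorm_op_add:
  assumes "self_adjoint T"
  shows "sqnorm_op T (u + v) = sqnorm_op T u + 2 * (u \<bullet> T v) + sqnorm_op T v"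
  using assms self_adjoint_swap[OF assms, of v u]
  by (simp add: sqnorm_op_def linear_add[OF self_adjoint_linear] inner_add_left inner_add_right
      inner_commute)

lemma sqnorm_op_scaleR:
  assumes "self_adjoint T"
  shows "sqnorm_op T (t *\<^sub>R u) = t\<^sup>2 * sqnorm_op T u"
  by (simp add: sqnorm_op_def linear_cmul[OF self_adjoint_linear[OF assms]] power2_eq_square)

lemma sqnorm_op_uminus:
  assumes "self_adjoint T"
  shows "sqnorm_op T (- u) = sqnorm_op T u"
  using sqnorm_op_scaleR[OF assms, of "-1" u] by simp

lemma sqnorm_op_diff:
  assumes "self_adjoint T"
  shows "sqnorm_op T (u - v) = sqnorm_op T u - 2 * (u \<bullet> T v) + sqnorm_op T v"
  using sqnorm_op_add[OF assms, of u "- v"] sqnorm_op_uminus[OF assms, of v]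
  by (simp add: linear_neg[OF self_adjoint_linear[OF assms]])

lemma three_point_identity:
  assumes "self_adjoint T"
  shows "2 * (T (u - v) \<bullet> (u - w))
    = sqnorm_op T (u - w) - sqnorm_op T (v - w) + sqnorm_op T (u - v)"
proof -
  have "v - w = (u - w) - (u - v)" by simp
  then have "sqnorm_op T (v - w)
    = sqnorm_op T (u - w) - 2 * ((u - w) \<bullet> T (u - v)) + sqnorm_op T (u - v)"
    using sqnorm_op_diff[OF assms] by metis
  then show ?thesis by (simp add: inner_commute)
qed

lemma two_psd_le:
  assumes "psd T"
  shows "2 * (u \<bullet> T v) \<le> sqnorm_op T u + sqnorm_op T v"
  using psd_sqnorm_nonneg[OF assms, of "u - v"] sqnorm_op_diff[OF psd_self_adjoint[OF assms]]
  by fastforce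

lemma sqnorm_op_add_le:
  assumes "psd T"
  shows "sqnorm_op T (u + v) \<le> 2 * sqnorm_op T u + 2 * sqnorm_op T v"
  using two_psd_le[OF assms, of u v] sqnorm_op_add[OF psd_self_adjoint[OF assms], of u v] by simp

lemma sqnorm_op_diff_le:
  assumes "psd T"
  shows "sqnorm_op T (u - v) \<le> 2 * sqnorm_op T u + 2 * sqnorm_op T v"
  using sqnorm_op_add_le[OF assms, of u "- v"] sqnorm_op_uminus[OF psd_self_adjoint[OF assms], of v]
  by simp

lemma pd_cauchy_schwarz:
  assumes "pd T"
  shows "\<bar>u \<bullet> T v\<bar> \<le> norm_op T u * norm_op T v"
proof (cases "v = 0")
  case True
  then show ?thesis
    by (simp add: norm_op_def linear_0[OF self_adjoint_linear[OF pd_self_adjoint[OF assms]]])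
next
  case False
  let ?a = "sqnorm_op T u" and ?b = "u \<bullet> T v" and ?c = "sqnorm_op T v"
  have sa: "self_adjoint T" by (rule pd_self_adjoint[OF assms])
  have c: "?c > 0" using assms False by (simp add: pd_def sqnorm_op_def)
  have "0 \<le> sqnorm_op T (u - (?b / ?c) *\<^sub>R v)"
    by (rule psd_sqnorm_nonneg[OF pd_imp_psd[OF assms]])
  also have "\<dots> = ?a - 2 * (?b / ?c) * ?b + (?b / ?c)\<^sup>2 * ?c"
    by (simp add: sqnorm_op_diff[OF sa] sqnorm_op_scaleR[OF sa]
        linear_cmul[OF self_adjoint_linear[OF sa]])
  also have "\<dots> = ?a - ?b\<^sup>2 / ?c"
    using c by (simp add: power2_eq_square field_simps)
  finally have "?b\<^sup>2 \<le> ?a * ?c" using c by (simp add: field_simps)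
  then have "sqrt (?b\<^sup>2) \<le> sqrt (?a * ?c)" by (rule real_sqrt_le_mono)
  then show ?thesis by (simp add: norm_op_def sqnorm_op_def real_sqrt_mult)
qed

lemma norm_op_nonneg_sq:
  assumes "psd T"
  shows "0 \<le> norm_op T u" "(norm_op T u)\<^sup>2 = sqnorm_op T u"
  using psd_sqnorm_nonneg[OF assms, of u] by (auto simp: norm_op_def sqnorm_op_def)

lemma pd_bij:
  fixes T :: "'a::euclidean_space \<Rightarrow> 'a"
  assumes "pd T"
  shows "bij T"
proof -
  have lin: "linear T" by (rule self_adjoint_linear[OF pd_self_adjoint[OF assms]])
  have "inj T"
    unfolding linear_injective_0[OF lin] using assms
    by (metis inner_zero_right less_irrefl pd_def)
  then show ?thesis
    using linear_injective_imp_surjective[OF lin] by (simp add: bij_def)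
qed

text \<open>Cauchy--Schwarz for the pair of dual norms of \<open>F\<close> and \<open>inv F\<close>: write \<open>v = F w\<close>; then
  \<open>w\<close> has squared \<open>F\<close>-norm \<open>v \<bullet> inv F v\<close>, which the Loewner bound compares with \<open>T\<close>.\<close>

lemma inner_le_dual_norms:
  fixes F :: "'a::euclidean_space \<Rightarrow> 'a"
  assumes "pd F" and "loewner_le (inv F) T"
  shows "\<bar>e \<bullet> v\<bar> \<le> norm_op F e * norm_op T v"
proof -
  let ?w = "inv F v"
  have w: "F ?w = v" using pd_bij[OF assms(1)] by (simp add: bij_is_surj surj_f_inv_f)
  have "0 \<le> v \<bullet> (T v - ?w)" using assms(2) by (simp add: loewner_le_def psd_def)
  then have "?w \<bullet> F ?w \<le> v \<bullet> T v" by (simp add: w inner_diff_right inner_commute)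
  then have "norm_op F ?w \<le> norm_op T v" by (simp add: norm_op_def)
  moreover have "\<bar>e \<bullet> F ?w\<bar> \<le> norm_op F e * norm_op F ?w"
    by (rule pd_cauchy_schwarz[OF assms(1)])
  ultimately show ?thesis
    using norm_op_nonneg_sq(1)[OF pd_imp_psd[OF assms(1)], of e]
    by (metis mult_left_mono order_trans w)
qed

text \<open>This is the only form in which the stopping criterion enters the analysis: a subgradient \<open>e\<close>
  that is small relative to the step \<open>d\<close> can be paired with an arbitrary \<open>v\<close> at the price of
  \<open>\<mu>\<close> times quantities that the descent argument controls.\<close>

lemma two_relative_error_le:
  fixes F :: "'a::euclidean_space \<Rightarrow> 'a"
  assumes "pd F" and "pd T" and "loewner_le (inv F) T"
    and "norm_op F e \<le> \<mu> * norm_op T d" and "0 \<le> \<mu>"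
  shows "2 * \<bar>e \<bullet> v\<bar> \<le> \<mu> * (sqnorm_op T d + sqnorm_op T v)"
proof -
  note nn = norm_op_nonneg_sq[OF pd_imp_psd[OF assms(2)]]
  have "2 * \<bar>e \<bullet> v\<bar> \<le> 2 * (norm_op F e * norm_op T v)"
    using inner_le_dual_norms[OF assms(1,3)] by simp
  also have "\<dots> \<le> 2 * (\<mu> * norm_op T d * norm_op T v)"
    using mult_right_mono[OF assms(4) nn(1)] by simp
  also have "\<dots> = \<mu> * (2 * norm_op T d * norm_op T v)" by simp
  also have "\<dots> \<le> \<mu> * ((norm_op T d)\<^sup>2 + (norm_op T v)\<^sup>2)"
    by (rule mult_left_mono[OF sum_squares_bound assms(5)])
  finally show ?thesis by (simp add: nn(2))
qed

text \<open>The constant is the minimum of the quadratic form on the unit sphere, which is compact.\<close>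

lemma pd_coercive:
  fixes T :: "'a::euclidean_space \<Rightarrow> 'a"
  assumes "pd T"
  obtains m where "m > 0" "\<And>u. m * (norm u)\<^sup>2 \<le> sqnorm_op T u"
proof -
  have sa: "self_adjoint T" by (rule pd_self_adjoint[OF assms])
  have "continuous_on (sphere 0 1) (sqnorm_op T)"
    unfolding sqnorm_op_def
    using linear_continuous_on[of T] linear_linear[of T] self_adjoint_linear[OF sa]
    by (auto intro!: continuous_intros)
  then obtain p where p: "p \<in> sphere 0 1" "\<And>u. u \<in> sphere 0 1 \<Longrightarrow> sqnorm_op T p \<le> sqnorm_op T u"
    using continuous_attains_inf[of "sphere (0::'a) 1" "sqnorm_op T"] by auto
  have "p \<noteq> 0" using p(1) by auto
  then have pos: "sqnorm_op T p > 0" using assms by (simp add: pd_def sqnorm_op_def)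
  have "sqnorm_op T p * (norm u)\<^sup>2 \<le> sqnorm_op T u" for u
  proof (cases "u = 0")
    case True then show ?thesis by (simp add: sqnorm_op_def)
  next
    case False
    then have "sqnorm_op T p \<le> sqnorm_op T ((1 / norm u) *\<^sub>R u)" by (intro p(2)) simp
    also have "\<dots> = sqnorm_op T u / (norm u)\<^sup>2"
      by (simp add: sqnorm_op_scaleR[OF sa] power_divide)
    finally show ?thesis using False by (simp add: pos_le_divide_eq)
  qed
  then show thesis using that pos by blast
qed

lemma pd_sqnorm_tendsto_zero:
  fixes T :: "'a::euclidean_space \<Rightarrow> 'a"
  assumes "pd T" and "(\<lambda>k. sqnorm_op T (u k)) \<longlonglongrightarrow> 0"
  shows "u \<longlonglongrightarrow> 0"
proof -
  obtain m where m: "m > 0" "\<And>v. m * (norm v)\<^sup>2 \<le> sqnorm_op T v" using pd_coercive[OF assms(1)] by blast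
  have "(\<lambda>k. sqnorm_op T (u k) / m) \<longlonglongrightarrow> 0" using tendsto_divide[OF assms(2), of "\<lambda>_. m" m] m by simp
  moreover have "(norm (u k))\<^sup>2 \<le> sqnorm_op T (u k) / m" for k
    using m(2)[of "u k"] m(1) by (simp add: field_simps)
  ultimately have "(\<lambda>k. (norm (u k))\<^sup>2) \<longlonglongrightarrow> 0"
    by (intro tendsto_sandwich[of "\<lambda>_. 0" "\<lambda>k. (norm (u k))\<^sup>2" sequentially
          "\<lambda>k. sqnorm_op T (u k) / m" 0]) auto
  then have "(\<lambda>k. sqrt ((norm (u k))\<^sup>2)) \<longlonglongrightarrow> sqrt 0" by (rule tendsto_real_sqrt)
  then show ?thesis by (simp add: tendsto_norm_zero_iff)
qed

lemma pd_sqnorm_bounded: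
  fixes T :: "'a::euclidean_space \<Rightarrow> 'a"
  assumes "pd T" and "\<And>k. sqnorm_op T (u k) \<le> M"
  shows "bounded (range u)"
proof -
  obtain m where m: "m > 0" "\<And>v. m * (norm v)\<^sup>2 \<le> sqnorm_op T v" using pd_coercive[OF assms(1)] by blast
  have "norm (u k) \<le> sqrt (M / m)" for k
  proof (rule real_le_rsqrt)
    show "(norm (u k))\<^sup>2 \<le> M / m"
      using order_trans[OF m(2)[of "u k"] assms(2)[of k]] m(1) by (simp add: field_simps)
  qed
  then show ?thesis unfolding bounded_iff by blast
qed

text \<open>By coercivity all points outside a large ball are farther away than some fixed point of
  \<open>\<Omega>\<close>, so only a compact part of \<open>\<Omega>\<close> matters.\<close>

lemma dist_op_attained:
  fixes T :: "'a::euclidean_space \<Rightarrow> 'a"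
  assumes "pd T" and "closed \<Omega>" and "\<Omega> \<noteq> {}"
  obtains e where "e \<in> \<Omega>" "norm_op T e = dist_op T 0 \<Omega>"
proof -
  obtain m where m: "m > 0" "\<And>v. m * (norm v)\<^sup>2 \<le> sqnorm_op T v" using pd_coercive[OF assms(1)] by blast
  note nn = norm_op_nonneg_sq[OF pd_imp_psd[OF assms(1)]]
  have cont: "continuous_on X (norm_op T)" for X
    unfolding norm_op_def
    using linear_continuous_on[of T] linear_linear[of T]
      self_adjoint_linear[OF pd_self_adjoint[OF assms(1)]]
    by (auto intro!: continuous_intros)
  obtain p where p: "p \<in> \<Omega>" using assms(3) by blast
  let ?R = "norm_op T p / sqrt m"
  have far: "norm_op T p \<le> norm_op T v" if "v \<notin> cball 0 ?R" for v
  proof -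
    have "?R \<le> norm v" using that by simp
    then have "norm_op T p \<le> sqrt m * norm v" using m(1) by (simp add: field_simps)
    also have "\<dots> = sqrt (m * (norm v)\<^sup>2)" by (simp add: real_sqrt_mult)
    also have "\<dots> \<le> norm_op T v"
      unfolding norm_op_def using m(2)[of v] by (simp add: sqnorm_op_def)
    finally show ?thesis .
  qed
  let ?K = "insert p (\<Omega> \<inter> cball 0 ?R)"
  have "compact ?K" using assms(2) by (intro compact_insert closed_Int_compact compact_cball)
  then obtain e where e: "e \<in> ?K" "\<And>v. v \<in> ?K \<Longrightarrow> norm_op T e \<le> norm_op T v"
    using continuous_attains_inf[OF _ _ cont, of ?K] by blast
  have min: "norm_op T e \<le> norm_op T v" if "v \<in> \<Omega>" for v
    using e(2)[of v] e(2)[of p] far[of v] that by fastforce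
  have "dist_op T 0 \<Omega> = norm_op T e"
    unfolding dist_op_def
  proof (intro antisym)
    show "(INF v\<in>\<Omega>. norm_op T (v - 0)) \<le> norm_op T e"
      using e(1) p nn(1) by (intro cINF_lower2[of _ _ e] bdd_belowI2[of _ 0]) auto
    show "norm_op T e \<le> (INF v\<in>\<Omega>. norm_op T (v - 0))"
      using assms(3) min by (intro cINF_greatest) auto
  qed
  then show thesis using that e(1) p by auto
qed

section \<open>Perturbed descent sequences\<close>

text \<open>The deterministic case of the Robbins--Siegmund lemma. Dividing by the partial products \<open>p\<close> of
  \<open>1 + \<alpha> k\<close>, which are bounded because \<open>\<alpha>\<close> is summable, removes the multiplicative
  perturbation; after that \<open>u / p\<close> plus the accumulated \<open>\<gamma>\<close> minus the accumulated
  \<open>\<beta>\<close> is nonincreasing and bounded below.\<close>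

lemma almost_supermartingale_convergence:
  fixes u \<alpha> \<beta> \<gamma> :: "nat \<Rightarrow> real"
  assumes nonneg: "\<And>k. 0 \<le> u k" "\<And>k. 0 \<le> \<alpha> k" "\<And>k. 0 \<le> \<beta> k" "\<And>k. 0 \<le> \<gamma> k"
    and sum: "summable \<alpha>" "summable \<beta>"
    and step: "\<And>k. u (Suc k) \<le> (1 + \<alpha> k) * u k + \<beta> k - \<gamma> k"
  shows "convergent u" and "summable \<gamma>"
proof -
  define p where "p k = (\<Prod>i<k. 1 + \<alpha> i)" for k
  have p_Suc: "p (Suc k) = (1 + \<alpha> k) * p k" for k by (simp add: p_def)
  have p_ge1: "1 \<le> p k" for k unfolding p_def using nonneg(2) by (intro prod_ge_1) simp
  have p_pos: "0 < p k" for k using p_ge1[of k] by simp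
  have "p k \<le> exp (suminf \<alpha>)" for k
  proof -
    have "p k \<le> (\<Prod>i<k. exp (\<alpha> i))"
      unfolding p_def using nonneg(2) by (intro prod_mono) (auto intro: add_nonneg_nonneg)
    also have "\<dots> = exp (\<Sum>i<k. \<alpha> i)" by (simp add: exp_sum)
    also have "\<dots> \<le> exp (suminf \<alpha>)" using sum_le_suminf[OF sum(1)] nonneg(2) by simp
    finally show ?thesis .
  qed
  then obtain M where M: "\<And>k. p k \<le> M" by blast
  have M0: "0 \<le> M" using M[of 0] p_pos[of 0] by linarith
  have "incseq p" unfolding incseq_Suc_iff p_Suc
    using nonneg(2) p_pos by (auto simp: distrib_right intro: mult_nonneg_nonneg less_imp_le)
  then have p_conv: "convergent p"
    using M p_ge1 by (intro Bseq_mono_convergent BseqI'[of p M])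
      (auto simp: incseq_def abs_of_pos[OF p_pos])
  define b where "b k = \<beta> k / p (Suc k)" for k
  define c where "c k = \<gamma> k / p (Suc k)" for k
  have b: "0 \<le> b k" "b k \<le> \<beta> k" for k
    unfolding b_def using nonneg(3)[of k] p_pos[of "Suc k"] p_ge1[of "Suc k"]
    by (auto simp: field_simps mult_le_cancel_left1)
  have c0: "0 \<le> c k" for k unfolding c_def using nonneg(4) p_pos by (simp add: less_imp_le)
  have b_sum: "summable b"
    using b by (intro summable_comparison_test'[OF sum(2), of 0]) (auto simp: abs_of_nonneg)
  define v where "v k = u k / p k" for k
  have v0: "0 \<le> v k" for k unfolding v_def using nonneg(1) p_pos by (simp add: less_imp_le)
  have v_step: "v (Suc k) \<le> v k + b k - c k" for k
  proof -
    have "v (Suc k) \<le> ((1 + \<alpha> k) * u k + \<beta> k - \<gamma> k) / p (Suc k)"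
      unfolding v_def using step p_pos by (simp add: divide_right_mono less_imp_le)
    also have "\<dots> = (1 + \<alpha> k) * u k / p (Suc k) + b k - c k"
      by (simp add: b_def c_def add_divide_distrib diff_divide_distrib)
    also have "(1 + \<alpha> k) * u k / p (Suc k) = v k"
      using nonneg(2)[of k] by (simp add: p_Suc v_def)
    finally show ?thesis .
  qed
  define w where "w k = v k + (\<Sum>i<k. c i) - (\<Sum>i<k. b i)" for k
  have "decseq w" unfolding decseq_Suc_iff w_def using v_step by (simp add: algebra_simps)
  then have w_le: "w k \<le> w 0" for k by (simp add: decseq_def)
  have c_le: "(\<Sum>i<k. c i) \<le> w 0 + suminf b" for k
    using w_le[of k] v0[of k] sum_le_suminf[OF b_sum, of "{..<k}"] b(1) unfolding w_def by force
  have c_sum: "summable c"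
  proof (rule bounded_imp_summable[of c "w 0 + suminf b"])
    show "(\<Sum>i\<le>n. c i) \<le> w 0 + suminf b" for n
      using c_le[of "Suc n"] by (simp only: lessThan_Suc_atMost)
  qed (rule c0)
  have "\<gamma> k \<le> M * c k" for k
    unfolding c_def using mult_right_mono[OF M[of "Suc k"] nonneg(4)[of k]] p_pos[of "Suc k"]
    by (simp add: field_simps)
  then show "summable \<gamma>"
    using nonneg(4)
    by (intro summable_comparison_test'[OF summable_mult[OF c_sum, of M], of 0]) auto
  have "- suminf b \<le> w k" for k
    using v0[of k] sum_le_suminf[OF b_sum, of "{..<k}"] b(1) c0
      sum_nonneg[of "{..<k}" c] unfolding w_def by force
  then have "convergent w"
    using decseq_convergent[OF \<open>decseq w\<close>] convergentI by metis
  moreover have "convergent (\<lambda>k. \<Sum>i<k. c i)" "convergent (\<lambda>k. \<Sum>i<k. b i)"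
    using c_sum b_sum by (auto simp: summable_iff_convergent)
  ultimately have "convergent (\<lambda>k. w k - (\<Sum>i<k. c i) + (\<Sum>i<k. b i))"
    by (intro convergent_add convergent_diff)
  then have "convergent v" unfolding w_def by simp
  then have "convergent (\<lambda>k. v k * p k)" using p_conv by (rule convergent_mult)
  moreover have "(\<lambda>k. v k * p k) = u" unfolding v_def using p_pos by (auto simp: less_imp_neq[symmetric])
  ultimately show "convergent u" by simp
qed

text \<open>Here the perturbation is proportional to quantities at the new index, so it cannot be read as an
  explicit recursion. Once \<open>\<epsilon>\<close> is small, the two step terms are absorbed by the decrease
  \<open>d * D\<close>; to have a decrease available for \<open>D k\<close> as well as for \<open>D (Suc k)\<close>, half of
  it is carried over to the next index inside \<open>u\<close>. The factor \<open>1 - \<epsilon> k\<close> in front of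
  the new value is then inverted, which costs at most \<open>1 + 2 * \<epsilon> k\<close>.\<close>

lemma perturbed_descent_convergence:
  fixes a b D \<epsilon> :: "nat \<Rightarrow> real"
  assumes nonneg: "\<And>k. 0 \<le> a k" "\<And>k. 0 \<le> b k" "\<And>k. 0 \<le> D k" "\<And>k. 0 \<le> \<epsilon> k"
    and d: "0 < d"
    and sum: "summable b" "summable \<epsilon>"
    and step: "\<And>k. a (Suc k) \<le> a k - d * D (Suc k) + b k
                          + \<epsilon> k * (a (Suc k) + D (Suc k) + D k)"
  shows "convergent a" and "D \<longlonglongrightarrow> 0"
proof -
  define \<delta> where "\<delta> = min (1 / 2) (d / 4)"
  have "\<epsilon> \<longlonglongrightarrow> 0" by (rule summable_LIMSEQ_zero[OF sum(2)])
  then have "eventually (\<lambda>k. \<epsilon> k < \<delta>) sequentially"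
    using d by (intro order_tendstoD(2)) (auto simp: \<delta>_def)
  then obtain N where N: "\<And>k. k \<ge> N \<Longrightarrow> \<epsilon> k < \<delta>" by (auto simp: eventually_sequentially)
  define u where "u k = a (k + N) + d / 2 * D (k + N)" for k
  have u0: "0 \<le> u k" for k using nonneg d by (simp add: u_def)
  have u_step: "u (Suc k) \<le> (1 + 2 * \<epsilon> (k + N)) * u k + 2 * b (k + N) - d / 4 * D (k + N)" for k
  proof -
    let ?e = "\<epsilon> (k + N)" and ?D = "D (k + N)" and ?D' = "D (Suc (k + N))"
    have e: "0 \<le> ?e" "?e \<le> 1 / 2" "?e \<le> d / 4"
      using N[of "k + N"] nonneg(4) by (auto simp: \<delta>_def)
    have "?e * (?D' + ?D) \<le> d / 4 * (?D' + ?D)"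
      using e(3) nonneg(3) by (intro mult_right_mono) auto
    then have "u (Suc k) \<le> u k - d / 4 * (?D' + ?D) + b (k + N) + ?e * a (Suc (k + N))"
      using step[of "k + N"] by (simp add: u_def algebra_simps)
    also have "\<dots> \<le> u k - d / 4 * ?D + b (k + N) + ?e * u (Suc k)"
      using nonneg(3)[of "Suc (k + N)"] d e(1) by (simp add: u_def algebra_simps)
    finally have "(1 - ?e) * u (Suc k) \<le> u k + b (k + N) - d / 4 * ?D" by (simp add: algebra_simps)
    then have 1: "u (Suc k) + d / 4 * ?D \<le> u k + b (k + N) + ?e * u (Suc k)"
      by (simp add: algebra_simps)
    have "?e * u (Suc k) \<le> 1 / 2 * u (Suc k)" using e(2) u0 by (rule mult_right_mono)
    moreover have "0 \<le> d / 4 * ?D" using d nonneg(3) by simp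
    ultimately have "u (Suc k) \<le> 2 * (u k + b (k + N))" using 1 by argo
    then have "?e * u (Suc k) \<le> ?e * (2 * (u k + b (k + N)))" using e(1) by (rule mult_left_mono)
    moreover have "?e * b (k + N) \<le> 1 / 2 * b (k + N)" using e(2) nonneg(2) by (rule mult_right_mono)
    ultimately show ?thesis using 1 by (simp add: algebra_simps)
  qed
  have sums: "summable (\<lambda>k. 2 * \<epsilon> (k + N))" "summable (\<lambda>k. 2 * b (k + N))"
    using sum by (auto intro!: summable_mult summable_ignore_initial_segment)
  note conv = almost_supermartingale_convergence[where u = u and \<alpha> = "\<lambda>k. 2 * \<epsilon> (k + N)"
      and \<beta> = "\<lambda>k. 2 * b (k + N)" and \<gamma> = "\<lambda>k. d / 4 * D (k + N)", OF _ _ _ _ sums u_step]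
  have "summable (\<lambda>k. d / 4 * D (k + N))" using u0 nonneg d by (intro conv(2)) auto
  then have "summable (\<lambda>k. D (k + N))" using d by (simp add: summable_cmult_iff)
  then show D0: "D \<longlonglongrightarrow> 0" using summable_LIMSEQ_zero summable_iff_shift by blast
  have "convergent u" using u0 nonneg d by (intro conv(1)) auto
  moreover have "convergent (\<lambda>k. D (k + N))" using D0 LIMSEQ_ignore_initial_segment convergentI by blast
  ultimately have "convergent (\<lambda>k. u k - d / 2 * D (k + N))"
    by (intro convergent_diff convergent_mult convergent_const)
  then have "convergent (\<lambda>k. a (k + N))" by (simp add: u_def)
  then show "convergent a" by (simp add: convergent_ignore_initial_segment)
qed

section \<open>Subgradients, multipliers and duality\<close>

lemma closed_proper_convex_finite:
  assumes "closed_proper_convex f" and "u \<in> edom f"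
  obtains r where "f u = ereal r"
  using assms by (cases "f u") (auto simp: closed_proper_convex_def edom_def)

lemma convex_combination_le:
  assumes "closed_proper_convex f" and "f u \<le> ereal a" and "f v \<le> ereal b"
    and "0 \<le> t" and "t \<le> 1"
  shows "f ((1 - t) *\<^sub>R u + t *\<^sub>R v) \<le> ereal ((1 - t) * a + t * b)"
proof -
  have "(u, a) \<in> eepigraph f" "(v, b) \<in> eepigraph f" using assms(2,3) by (auto simp: eepigraph_def)
  moreover have "convex (eepigraph f)" using assms(1) by (simp add: closed_proper_convex_def)
  ultimately have "(1 - t) *\<^sub>R (u, a) + t *\<^sub>R (v, b) \<in> eepigraph f"
    using assms(4,5) by (intro convexD) auto
  then show ?thesis by (simp add: eepigraph_def)
qed

lemma convex_edom:
  assumes "closed_proper_convex f"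
  shows "convex (edom f)"
proof (rule convexI)
  fix u v and s t :: real
  assume uv: "u \<in> edom f" "v \<in> edom f" and st: "0 \<le> s" "0 \<le> t" "s + t = 1"
  obtain a b where "f u = ereal a" "f v = ereal b"
    using closed_proper_convex_finite[OF assms] uv by metis
  then have "f ((1 - t) *\<^sub>R u + t *\<^sub>R v) \<le> ereal ((1 - t) * a + t * b)"
    using st by (intro convex_combination_le[OF assms]) auto
  moreover have "1 - t = s" using st by simp
  ultimately show "s *\<^sub>R u + t *\<^sub>R v \<in> edom f" by (auto simp: edom_def)
qed

lemma subdiff_in_edom:
  assumes "closed_proper_convex f" and "s \<in> subdiff f u"
  shows "u \<in> edom f"
proof (rule ccontr)
  assume "u \<notin> edom f"
  then have u: "f u = \<infinity>" by (simp add: edom_def)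
  obtain v where "f v < \<infinity>" using assms(1) by (auto simp: closed_proper_convex_def edom_def)
  moreover have "f u + ereal (s \<bullet> (v - u)) \<le> f v" using assms(2) by (simp add: subdiff_def)
  ultimately show False using u by simp
qed

lemma closed_subdiff:
  fixes \<phi> :: "'a::euclidean_space \<Rightarrow> ereal"
  assumes "\<phi> u = ereal r"
  shows "closed (subdiff \<phi> u)"
proof -
  have "subdiff \<phi> u = (\<Inter>v. {s. ereal (r + s \<bullet> (v - u)) \<le> \<phi> v})"
    by (auto simp: subdiff_def assms)
  moreover have "closed {s. ereal (r + s \<bullet> (v - u)) \<le> \<phi> v}" for v
    by (intro closed_Collect_le continuous_intros)
  ultimately show ?thesis by auto
qed

text \<open>For fixed \<open>v\<close> in the domain the subgradient inequality says that the point
  \<open>(u k, f v - s k \<bullet> (v - u k))\<close> lies in the epigraph, which is closed.\<close>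

lemma subdiff_graph_closed:
  assumes f: "closed_proper_convex f" and s: "\<And>k. s k \<in> subdiff f (u k)"
    and u_lim: "u \<longlonglongrightarrow> u0" and s_lim: "s \<longlonglongrightarrow> s0"
  shows "s0 \<in> subdiff f u0"
proof -
  have key: "f u0 + ereal (s0 \<bullet> (v - u0)) \<le> f v" for v
  proof (cases "v \<in> edom f")
    case False
    then show ?thesis by (simp add: edom_def)
  next
    case True
    then obtain b where b: "f v = ereal b" by (rule closed_proper_convex_finite[OF f])
    have mem: "(u k, b - s k \<bullet> (v - u k)) \<in> eepigraph f" for k
    proof -
      obtain a where a: "f (u k) = ereal a"
        using closed_proper_convex_finite[OF f subdiff_in_edom[OF f s]] .
      have "f (u k) + ereal (s k \<bullet> (v - u k)) \<le> f v" using s[of k] by (simp add: subdiff_def)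
      then show ?thesis by (simp add: eepigraph_def a b)
    qed
    have lim: "(\<lambda>k. (u k, b - s k \<bullet> (v - u k))) \<longlonglongrightarrow> (u0, b - s0 \<bullet> (v - u0))"
      using u_lim s_lim by (intro tendsto_intros)
    have cl: "closed (eepigraph f)" using f by (simp add: closed_proper_convex_def)
    have "(u0, b - s0 \<bullet> (v - u0)) \<in> eepigraph f"
      by (rule cl[unfolded closed_sequential_limits, rule_format, OF conjI[OF allI[OF mem] lim]])
    then have le: "f u0 \<le> ereal (b - s0 \<bullet> (v - u0))" by (simp add: eepigraph_def)
    then show ?thesis
      using b by (cases "f u0") auto
  qed
  then show ?thesis by (simp add: subdiff_def)
qed

text \<open>A second-order term does not influence the subdifferential of a convex function: at the point
  \<open>u + t *\<^sub>R (v - u)\<close> convexity makes all first-order terms scale like \<open>t\<close> and the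
  quadratic term like \<open>t\<^sup>2\<close>, so dividing by \<open>t\<close> and letting \<open>t\<close> tend to 0
  removes it. \<open>Q\<close> may be indefinite, as the proximal operators are.\<close>

lemma subdiff_remove_quadratic:
  assumes f: "closed_proper_convex f" and u: "u \<in> edom f"
    and ineq: "\<And>v. f u + ereal (s \<bullet> (v - u)) \<le> f v + ereal (d \<bullet> (v - u) + sqnorm_op Q (v - u))"
    and Q: "self_adjoint Q"
  shows "s - d \<in> subdiff f u"
proof -
  obtain a where a: "f u = ereal a" using closed_proper_convex_finite[OF f u] .
  have "f u + ereal ((s - d) \<bullet> (v - u)) \<le> f v" for v
  proof (cases "v \<in> edom f")
    case False
    then show ?thesis by (simp add: edom_def)
  next
    case True
    then obtain b where b: "f v = ereal b" by (rule closed_proper_convex_finite[OF f])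
    let ?w = "v - u" and ?q = "sqnorm_op Q (v - u)"
    have small: "(s - d) \<bullet> ?w \<le> b - a + t * ?q" if t: "t > 0" "t \<le> 1" for t :: real
    proof -
      let ?p = "(1 - t) *\<^sub>R u + t *\<^sub>R v"
      have p: "?p - u = t *\<^sub>R ?w" by (simp add: algebra_simps)
      have "f ?p \<le> ereal ((1 - t) * a + t * b)"
        using t by (intro convex_combination_le[OF f]) (auto simp: a b)
      then have "ereal a + ereal (s \<bullet> (?p - u))
          \<le> ereal ((1 - t) * a + t * b) + ereal (d \<bullet> (?p - u) + sqnorm_op Q (?p - u))"
        using order_trans[OF ineq[of ?p] add_right_mono] by (simp only: a)
      then have "a + t * (s \<bullet> ?w) \<le> (1 - t) * a + t * b + t * (d \<bullet> ?w) + t\<^sup>2 * ?q"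
        unfolding p sqnorm_op_scaleR[OF Q] by simp
      then have "t * ((s - d) \<bullet> ?w) \<le> t * (b - a + t * ?q)"
        by (simp add: algebra_simps inner_diff_left power2_eq_square)
      then show ?thesis using t(1) by simp
    qed
    have "((\<lambda>t. b - a + t * ?q) \<longlongrightarrow> b - a + 0 * ?q) (at_right 0)" by (intro tendsto_intros)
    moreover have "eventually (\<lambda>t. (s - d) \<bullet> ?w \<le> b - a + t * ?q) (at_right 0)"
      using small by (auto simp: eventually_at_right_field intro!: exI[of _ 1])
    ultimately have "(s - d) \<bullet> ?w \<le> b - a + 0 * ?q"
      by (intro tendsto_lowerbound[of _ _ "at_right (0::real)"]) auto
    then show ?thesis by (simp add: a b)
  qed
  then show ?thesis by (simp add: subdiff_def)
qed

definition kkt_point ::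
  "('x::euclidean_space \<Rightarrow> ereal) \<Rightarrow> ('y::euclidean_space \<Rightarrow> ereal) \<Rightarrow>
   ('z::euclidean_space \<Rightarrow> 'x) \<Rightarrow> ('z \<Rightarrow> 'y) \<Rightarrow> 'z \<Rightarrow> 'x \<Rightarrow> 'y \<Rightarrow> 'z \<Rightarrow> bool" where
  "kkt_point f g A B c x y z \<longleftrightarrow>
     - A z \<in> subdiff f x \<and> - B z \<in> subdiff g y \<and> residual A B c x y = 0"

lemma conjugate_at_subgradient:
  assumes "f u = ereal r" and "s \<in> subdiff f u"
  shows "conjugate f s = ereal (s \<bullet> u - r)"
  unfolding conjugate_def
proof (rule antisym)
  show "(SUP v. ereal (s \<bullet> v) - f v) \<le> ereal (s \<bullet> u - r)"
  proof (rule SUP_least)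
    fix v
    have "ereal (r + s \<bullet> (v - u)) \<le> f v" using assms by (auto simp: subdiff_def)
    then show "ereal (s \<bullet> v) - f v \<le> ereal (s \<bullet> u - r)"
      by (cases "f v") (auto simp: inner_diff_right)
  qed
  have "ereal (s \<bullet> u - r) = ereal (s \<bullet> u) - f u" by (simp add: assms(1))
  also have "\<dots> \<le> (SUP v. ereal (s \<bullet> v) - f v)" by (rule SUP_upper) simp
  finally show "ereal (s \<bullet> u - r) \<le> (SUP v. ereal (s \<bullet> v) - f v)" .
qed

lemma conjugate_ge:
  assumes "f u = ereal r"
  shows "ereal (s \<bullet> u - r) \<le> conjugate f s"
proof -
  have "ereal (s \<bullet> u - r) = ereal (s \<bullet> u) - f u" by (simp add: assms(1))
  also have "\<dots> \<le> conjugate f s" unfolding conjugate_def by (rule SUP_upper) simp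
  finally show ?thesis .
qed

context
  fixes f :: "'x::euclidean_space \<Rightarrow> ereal" and g :: "'y::euclidean_space \<Rightarrow> ereal"
    and A :: "'z::euclidean_space \<Rightarrow> 'x" and B :: "'z \<Rightarrow> 'y" and c :: 'z
  assumes f: "closed_proper_convex f" and g: "closed_proper_convex g"
    and A: "linear A" and B: "linear B"
begin

lemma multiplier_inner_residual:
  "z \<bullet> residual A B c x y = A z \<bullet> x + B z \<bullet> y - c \<bullet> z"
  using adjoint_works[OF A, of z x] adjoint_works[OF B, of z y]
  by (simp add: residual_def inner_diff_right inner_add_right inner_commute)

lemma kkt_primal_solution:
  assumes "kkt_point f g A B c x y z"
  shows "primal_solution f g A B c x y"
proof -
  have sf: "- A z \<in> subdiff f x" and sg: "- B z \<in> subdiff g y" and r: "residual A B c x y = 0"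
    using assms by (auto simp: kkt_point_def)
  have dom: "x \<in> edom f" "y \<in> edom g"
    using subdiff_in_edom[OF f sf] subdiff_in_edom[OF g sg] by auto
  obtain a b where ab: "f x = ereal a" "g y = ereal b"
    using closed_proper_convex_finite[OF f dom(1)] closed_proper_convex_finite[OF g dom(2)] by metis
  have "f x + g y \<le> f x' + g y'" if feas: "adjoint A x' + adjoint B y' = c" for x' y'
  proof -
    have "residual A B c x' y' = 0" using feas by (simp add: residual_def)
    then have "A z \<bullet> x' + B z \<bullet> y' = A z \<bullet> x + B z \<bullet> y"
      using multiplier_inner_residual[of z x' y'] multiplier_inner_residual[of z x y] r by simp
    then have "a + b = (a + (- A z) \<bullet> (x' - x)) + (b + (- B z) \<bullet> (y' - y))"
      by (simp add: inner_diff_right)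
    then have "f x + g y = (f x + ereal ((- A z) \<bullet> (x' - x))) + (g y + ereal ((- B z) \<bullet> (y' - y)))"
      by (simp add: ab)
    also have "\<dots> \<le> f x' + g y'" using sf sg by (intro add_mono) (auto simp: subdiff_def)
    finally show ?thesis .
  qed
  moreover have "adjoint A x + adjoint B y = c" using r by (simp add: residual_def)
  ultimately show ?thesis using dom by (auto simp: primal_solution_def)
qed

text \<open>By the Fenchel equality at a subgradient the dual value at \<open>z\<close> is \<open>f x + g y\<close>, and the
  Fenchel inequality at the feasible pair \<open>(x, y)\<close> shows that no dual value is larger.\<close>

lemma kkt_dual_solution:
  assumes "kkt_point f g A B c x y z"
  shows "dual_solution f g A B c z"
proof -
  have sf: "- A z \<in> subdiff f x" and sg: "- B z \<in> subdiff g y" and r: "residual A B c x y = 0"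
    using assms by (auto simp: kkt_point_def)
  have dom: "x \<in> edom f" "y \<in> edom g"
    using subdiff_in_edom[OF f sf] subdiff_in_edom[OF g sg] by auto
  obtain a b where ab: "f x = ereal a" "g y = ereal b"
    using closed_proper_convex_finite[OF f dom(1)] closed_proper_convex_finite[OF g dom(2)] by metis
  have res: "A z' \<bullet> x + B z' \<bullet> y = c \<bullet> z'" for z'
    using multiplier_inner_residual[of z' x y] r by simp
  have val: "dual_objective f g A B c z = ereal (a + b)"
    unfolding dual_objective_def conjugate_at_subgradient[OF ab(1) sf]
      conjugate_at_subgradient[OF ab(2) sg] using res[of z] by simp
  have "dual_objective f g A B c z' \<le> ereal (a + b)" for z'
  proof -
    have fz: "ereal ((- A z') \<bullet> x - a) \<le> conjugate f (- A z')"
      and gz: "ereal ((- B z') \<bullet> y - b) \<le> conjugate g (- B z')"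
      using conjugate_ge[where f = f and u = x, OF ab(1)] conjugate_ge[where f = g and u = y, OF ab(2)]
      by blast+
    show ?thesis
      using fz gz res[of z'] unfolding dual_objective_def
      by (cases "conjugate f (- A z')"; cases "conjugate g (- B z')") auto
  qed
  then show ?thesis by (simp add: dual_solution_def val)
qed

lemma residual_affine:
  "residual A B c ((1 - t) *\<^sub>R x + t *\<^sub>R x') ((1 - t) *\<^sub>R y + t *\<^sub>R y')
    = (1 - t) *\<^sub>R residual A B c x y + t *\<^sub>R residual A B c x' y'"
  unfolding residual_def linear_add[OF adjoint_linear[OF A]] linear_add[OF adjoint_linear[OF B]]
    linear_cmul[OF adjoint_linear[OF A]] linear_cmul[OF adjoint_linear[OF B]]
  by (simp add: algebra_simps)

text \<open>Existence of a Lagrange multiplier by separation. The set \<open>C\<close> of pairs (residual, attainable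
  excess over the optimal value) is convex, and optimality keeps the origin out of its relative
  interior; a supporting hyperplane \<open>(w, \<beta>)\<close> there that does not contain all of \<open>C\<close>
  has \<open>\<beta> \<ge> 0\<close>. It is not vertical, because a vertical one would bound \<open>w \<bullet> h\<close> from
  below by 0 on the domain while this affine function vanishes at a relative interior point,
  hence everywhere, so that the hyperplane would contain \<open>C\<close>. Normalising \<open>\<beta>\<close> to 1 gives the multiplier.\<close>

lemma kkt_point_exists:
  assumes "assumption_A f g A B c"
  obtains x y z where "kkt_point f g A B c x y z"
proof -
  let ?h = "residual A B c"
  obtain x0 y0 xi yi where opt: "primal_solution f g A B c x0 y0"
    and ri: "(xi, yi) \<in> rel_interior (edom f \<times> edom g)" and feas: "adjoint A xi + adjoint B yi = c"
    using assms by (auto simp: assumption_A_def)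
  have dom: "x0 \<in> edom f" "y0 \<in> edom g" and h0: "?h x0 y0 = 0"
    using opt by (auto simp: primal_solution_def residual_def)
  obtain a0 b0 where ab0: "f x0 = ereal a0" "g y0 = ereal b0"
    using closed_proper_convex_finite[OF f dom(1)] closed_proper_convex_finite[OF g dom(2)] by metis
  define C where "C = {(?h x y, r) | x y r. \<exists>a b. f x \<le> ereal a \<and> g y \<le> ereal b \<and> a + b \<le> a0 + b0 + r}"
  have C_I: "(?h x y, r) \<in> C" if "f x \<le> ereal a" "g y \<le> ereal b" "a + b \<le> a0 + b0 + r" for x y r a b
    using that unfolding C_def by blast
  have "convex C"
    unfolding convex_alt
  proof (intro ballI allI impI)
    fix p q and t :: real
    assume "p \<in> C" "q \<in> C" and t: "0 \<le> t \<and> t \<le> 1"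
    then obtain x y r a b x' y' r' a' b' where
      p: "p = (?h x y, r)" "f x \<le> ereal a" "g y \<le> ereal b" "a + b \<le> a0 + b0 + r" and
      q: "q = (?h x' y', r')" "f x' \<le> ereal a'" "g y' \<le> ereal b'" "a' + b' \<le> a0 + b0 + r'"
      unfolding C_def by blast
    have "(1 - t) * (a + b) + t * (a' + b') \<le> (1 - t) * (a0 + b0 + r) + t * (a0 + b0 + r')"
      using mult_left_mono[OF p(4), of "1 - t"] mult_left_mono[OF q(4), of t] t by simp
    then have sum: "((1 - t) * a + t * a') + ((1 - t) * b + t * b') \<le> a0 + b0 + ((1 - t) * r + t * r')"
      by (simp add: algebra_simps)
    have "(?h ((1 - t) *\<^sub>R x + t *\<^sub>R x') ((1 - t) *\<^sub>R y + t *\<^sub>R y'), (1 - t) * r + t * r') \<in> C"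
      using convex_combination_le[OF f p(2) q(2)] convex_combination_le[OF g p(3) q(3)] t sum
      by (intro C_I) auto
    then show "(1 - t) *\<^sub>R p + t *\<^sub>R q \<in> C" by (simp add: p(1) q(1) residual_affine)
  qed
  have zero: "(0, 0) \<in> C" and one: "(0, 1) \<in> C"
    using C_I[of x0 a0 y0 b0 0] C_I[of x0 a0 y0 b0 1] by (auto simp: ab0 h0)
  have "(0, 0) \<notin> rel_interior C"
  proof
    assume "(0, 0) \<in> rel_interior C"
    \<comment> \<open>prolonging the segment from \<open>(0, 1)\<close> beyond the origin would beat the optimal value\<close>
    moreover have "C \<noteq> {}" using zero by blast
    ultimately have "\<forall>q\<in>C. \<exists>e>1. (1 - e) *\<^sub>R q + e *\<^sub>R (0, 0) \<in> C"
      using convex_rel_interior_iff[OF \<open>convex C\<close>, of "(0, 0)"] by blast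
    then obtain e where e: "e > 1" "(1 - e) *\<^sub>R (0, 1) + e *\<^sub>R (0, 0) \<in> C"
      using bspec[OF _ one] by blast
    then have "(0, 1 - e) \<in> C" by simp
    then obtain x y a b where xy: "?h x y = 0" "f x \<le> ereal a" "g y \<le> ereal b"
      "a + b \<le> a0 + b0 + (1 - e)"
      unfolding C_def by auto
    have "f x0 + g y0 \<le> f x + g y" using opt xy(1) by (auto simp: primal_solution_def residual_def)
    also have "\<dots> \<le> ereal a + ereal b" using xy by (intro add_mono)
    finally show False using xy(4) e(1) by (simp add: ab0)
  qed
  then obtain n where n: "\<And>q. q \<in> C \<Longrightarrow> n \<bullet> (0, 0) \<le> n \<bullet> q"
      "\<And>q. q \<in> rel_interior C \<Longrightarrow> n \<bullet> (0, 0) < n \<bullet> q"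
    using supporting_hyperplane_rel_boundary[OF \<open>convex C\<close> zero] by metis
  obtain w \<beta> where w: "n = (w, \<beta>)" by (cases n)
  have nonneg: "0 \<le> w \<bullet> h + \<beta> * r" if "(h, r) \<in> C" for h r using n(1)[OF that] by (simp add: w)
  obtain x1 y1 r1 a1 b1 where q1: "f x1 \<le> ereal a1" "g y1 \<le> ereal b1" "a1 + b1 \<le> a0 + b0 + r1"
      and pos1: "0 < w \<bullet> ?h x1 y1 + \<beta> * r1"
  proof -
    have "rel_interior C \<noteq> {}" using rel_interior_eq_empty[OF \<open>convex C\<close>] zero by auto
    then obtain q where "q \<in> rel_interior C" by blast
    then have "q \<in> C" "0 < n \<bullet> q" using rel_interior_subset n(2) by (auto simp: zero_prod_def[symmetric])
    then show thesis using that unfolding C_def by (auto simp: w)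
  qed
  have "0 \<le> \<beta>" using nonneg[OF one] by simp
  moreover have "\<beta> \<noteq> 0"
  proof
    assume b0: "\<beta> = 0"
    have D: "convex (edom f \<times> edom g)" by (intro convex_Times convex_edom f g)
    have "(x1, y1) \<in> edom f \<times> edom g" using q1 by (auto simp: edom_def)
    then obtain e where e: "e > 1" "(1 - e) *\<^sub>R (x1, y1) + e *\<^sub>R (xi, yi) \<in> edom f \<times> edom g"
      using convex_rel_interior_iff[OF D, of "(xi, yi)"] ri by auto
    let ?x = "(1 - e) *\<^sub>R x1 + e *\<^sub>R xi" and ?y = "(1 - e) *\<^sub>R y1 + e *\<^sub>R yi"
    have "?x \<in> edom f" "?y \<in> edom g" using e(2) by auto
    then obtain a b where "f ?x = ereal a" "g ?y = ereal b"
      using closed_proper_convex_finite[OF f] closed_proper_convex_finite[OF g] by metis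
    then have "(?h ?x ?y, a + b - (a0 + b0)) \<in> C" by (intro C_I) auto
    then have "0 \<le> w \<bullet> ?h ?x ?y" using nonneg b0 by fastforce
    also have "?h ?x ?y = (1 - e) *\<^sub>R ?h x1 y1"
      using residual_affine[of e x1 xi y1 yi] feas by (simp add: residual_def)
    finally have "0 \<le> (1 - e) * (w \<bullet> ?h x1 y1)" by simp
    moreover have "(1 - e) * (w \<bullet> ?h x1 y1) < 0"
      using pos1 b0 e(1) by (simp add: mult_neg_pos)
    ultimately show False by simp
  qed
  ultimately have \<beta>: "\<beta> > 0" by simp
  define z where "z = (1 / \<beta>) *\<^sub>R w"
  have lag: "a0 + b0 \<le> a + b + z \<bullet> ?h x y" if "f x = ereal a" "g y = ereal b" for x y a b
  proof -
    have "(?h x y, a + b - (a0 + b0)) \<in> C" using that by (intro C_I) auto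
    then have "0 \<le> (w \<bullet> ?h x y + \<beta> * (a + b - (a0 + b0))) / \<beta>" using nonneg \<beta> by simp
    also have "\<dots> = z \<bullet> ?h x y + (a + b - (a0 + b0))" using \<beta> by (simp add: z_def add_divide_distrib)
    finally show ?thesis by simp
  qed
  have "- A z \<in> subdiff f x0"
    unfolding subdiff_def
  proof (clarify)
    fix v
    show "f x0 + ereal (- A z \<bullet> (v - x0)) \<le> f v"
    proof (cases "v \<in> edom f")
      case True
      then obtain a where a: "f v = ereal a" by (rule closed_proper_convex_finite[OF f])
      show ?thesis
        using lag[OF a ab0(2)] multiplier_inner_residual[of z v y0] multiplier_inner_residual[of z x0 y0]
        by (simp add: a ab0 h0 inner_diff_right)
    qed (simp add: edom_def)
  qed
  moreover have "- B z \<in> subdiff g y0"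
    unfolding subdiff_def
  proof (clarify)
    fix v
    show "g y0 + ereal (- B z \<bullet> (v - y0)) \<le> g v"
    proof (cases "v \<in> edom g")
      case True
      then obtain b where b: "g v = ereal b" by (rule closed_proper_convex_finite[OF g])
      show ?thesis
        using lag[OF ab0(1) b] multiplier_inner_residual[of z x0 v] multiplier_inner_residual[of z x0 y0]
        by (simp add: b ab0 h0 inner_diff_right)
    qed (simp add: edom_def)
  qed
  ultimately show thesis using that h0 by (simp add: kkt_point_def)
qed

end

section \<open>Subgradients produced by the block updates\<close>

lemma sqnorm_T_op:
  assumes "linear A"
  shows "sqnorm_op (T_op \<sigma> A P S) u = sqnorm_op P u + sqnorm_op S u + \<sigma> * (norm (adjoint A u))\<^sup>2"
  using adjoint_works[OF assms, of "adjoint A u" u]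
  by (simp add: sqnorm_op_def T_op_def inner_add_right inner_commute power2_norm_eq_inner)

text \<open>Both block updates minimise a function of this shape. An error vector of least \<open>F\<close>-norm exists;
  expanding the smooth quadratic part exactly around \<open>u\<close> turns it into a subgradient of
  \<open>f\<close> itself.\<close>

lemma block_update_subgradient:
  fixes A :: "'z::euclidean_space \<Rightarrow> 'a::euclidean_space"
  assumes f: "closed_proper_convex f" and A: "linear A" and P: "self_adjoint P"
    and \<phi>: "\<phi> = (\<lambda>v. f v + ereal (C + z \<bullet> (adjoint A v + w) + \<sigma> / 2 * (norm (adjoint A v + w))\<^sup>2
                          + 1 / 2 * sqnorm_op P (v - a)))"
    and step: "approx_minimizer F T \<mu> \<phi> a u" and F: "pd F"
  obtains e where "norm_op F e \<le> \<mu> * norm_op T (u - a)"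
    and "e - P (u - a) - A (z + \<sigma> *\<^sub>R (adjoint A u + w)) \<in> subdiff f u"
proof -
  let ?q = "\<lambda>v. z \<bullet> (adjoint A v + w) + \<sigma> / 2 * (norm (adjoint A v + w))\<^sup>2 + 1 / 2 * sqnorm_op P (v - a)"
  have dom: "u \<in> edom f"
  proof (rule ccontr)
    assume "u \<notin> edom f"
    then have "\<phi> u = \<infinity>" by (simp add: edom_def \<phi>)
    moreover obtain v where "v \<in> edom f" using f by (auto simp: closed_proper_convex_def)
    moreover from this have "\<phi> v < \<infinity>" by (auto simp: edom_def \<phi>)
    moreover obtain s where "s \<in> subdiff \<phi> u" using step by (auto simp: approx_minimizer_def)
    then have "\<phi> u + ereal (s \<bullet> (v - u)) \<le> \<phi> v" by (simp add: subdiff_def)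
    ultimately show False by simp
  qed
  obtain r where r: "f u = ereal r" by (rule closed_proper_convex_finite[OF f dom])
  have "closed (subdiff \<phi> u)" by (rule closed_subdiff[of \<phi> u "r + (C + ?q u)"]) (simp add: \<phi> r)
  then obtain e where e: "e \<in> subdiff \<phi> u" "norm_op F e = dist_op F 0 (subdiff \<phi> u)"
    using dist_op_attained[OF F] step by (auto simp: approx_minimizer_def)
  let ?d = "P (u - a) + A (z + \<sigma> *\<^sub>R (adjoint A u + w))"
  let ?Q = "\<lambda>v. (1 / 2) *\<^sub>R P v + (\<sigma> / 2) *\<^sub>R A (adjoint A v)"
  note linP = self_adjoint_linear[OF P] and linA = adjoint_linear[OF A]
  have AA: "A p \<bullet> v = p \<bullet> adjoint A v" for p v
    using adjoint_works[OF A, of p v] by simp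
  have AA': "v \<bullet> A p = p \<bullet> adjoint A v" for p v
    using AA by (simp add: inner_commute)
  have "linear ?Q"
    by (intro linearI)
      (simp_all add: linear_add[OF linP] linear_cmul[OF linP] linear_add[OF A] linear_cmul[OF A]
        linear_add[OF linA] linear_cmul[OF linA] algebra_simps)
  then have Q: "self_adjoint ?Q"
    unfolding self_adjoint_def using self_adjoint_swap[OF P]
    by (auto simp: inner_add_left inner_add_right AA AA' inner_commute)
  have expand: "?q v = ?q u + ?d \<bullet> (v - u) + sqnorm_op ?Q (v - u)" for v
  proof -
    let ?h = "adjoint A u + w" and ?k = "adjoint A (v - u)"
    have hv: "adjoint A v + w = ?h + ?k" by (simp add: linear_diff[OF linA])
    have "(norm (?h + ?k))\<^sup>2 = (norm ?h)\<^sup>2 + 2 * (?h \<bullet> ?k) + (norm ?k)\<^sup>2"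
      by (simp add: power2_norm_eq_inner inner_add_left inner_add_right inner_commute)
    moreover have "sqnorm_op P (v - a) = sqnorm_op P (u - a) + 2 * (P (u - a) \<bullet> (v - u)) + sqnorm_op P (v - u)"
      using sqnorm_op_add[OF P, of "u - a" "v - u"] self_adjoint_swap[OF P, of "u - a" "v - u"] by simp
    moreover have "?d \<bullet> (v - u) = P (u - a) \<bullet> (v - u) + z \<bullet> ?k + \<sigma> * (?h \<bullet> ?k)"
      by (simp add: inner_add_left AA)
    moreover have "sqnorm_op ?Q (v - u) = 1 / 2 * sqnorm_op P (v - u) + \<sigma> / 2 * (norm ?k)\<^sup>2"
      by (simp add: sqnorm_op_def inner_add_right AA' power2_norm_eq_inner)
    ultimately show ?thesis unfolding hv by (simp add: inner_add_right algebra_simps)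
  qed
  have "e - ?d \<in> subdiff f u"
  proof (rule subdiff_remove_quadratic[OF f dom _ Q])
    fix v
    have "\<phi> u + ereal (e \<bullet> (v - u)) \<le> \<phi> v" using e(1) by (simp add: subdiff_def)
    then have "f u + ereal (C + ?q u) + ereal (e \<bullet> (v - u)) \<le> f v + ereal (C + ?q v)"
      by (simp add: \<phi> add.assoc)
    then show "f u + ereal (e \<bullet> (v - u)) \<le> f v + ereal (?d \<bullet> (v - u) + sqnorm_op ?Q (v - u))"
      unfolding expand[of v] r by (cases "f v") auto
  qed
  moreover have "e - ?d = e - P (u - a) - A (z + \<sigma> *\<^sub>R (adjoint A u + w))" by simp
  moreover have "norm_op F e \<le> \<mu> * norm_op T (u - a)"
    using step e(2) by (simp add: approx_minimizer_def)
  ultimately show thesis using that by simp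
qed

section \<open>Descent estimates for the inexact iteration\<close>

text \<open>What the descent analysis uses of one run: \<open>ef k\<close> and \<open>eg k\<close> are the error vectors of
  the step from \<open>k\<close> to \<open>Suc k\<close>, and \<open>\<epsilon> k\<close> bounds both relative tolerances of
  that step. The two inclusions are the optimality conditions of the block updates.\<close>

locale inexact_admm =
  fixes f :: "'x::euclidean_space \<Rightarrow> ereal" and g :: "'y::euclidean_space \<Rightarrow> ereal"
    and A :: "'z::euclidean_space \<Rightarrow> 'x" and B :: "'z \<Rightarrow> 'y" and c :: 'z
    and \<Sigma>f Pf :: "'x \<Rightarrow> 'x" and \<Sigma>g Pg :: "'y \<Rightarrow> 'y" and \<sigma> \<tau> :: real
    and x :: "nat \<Rightarrow> 'x" and y :: "nat \<Rightarrow> 'y" and z :: "nat \<Rightarrow> 'z"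
    and ef :: "nat \<Rightarrow> 'x" and eg :: "nat \<Rightarrow> 'y" and \<epsilon> :: "nat \<Rightarrow> real"
  assumes f: "closed_proper_convex f" and g: "closed_proper_convex g"
    and A: "linear A" and B: "linear B"
    and mono_f: "\<And>u u' s s'. s \<in> subdiff f u \<Longrightarrow> s' \<in> subdiff f u' \<Longrightarrow>
           sqnorm_op \<Sigma>f (u - u') \<le> (s - s') \<bullet> (u - u')"
    and mono_g: "\<And>u u' s s'. s \<in> subdiff g u \<Longrightarrow> s' \<in> subdiff g u' \<Longrightarrow>
           sqnorm_op \<Sigma>g (u - u') \<le> (s - s') \<bullet> (u - u')"
    and \<Sigma>f: "psd \<Sigma>f" and \<Sigma>g: "psd \<Sigma>g"
    and Pf: "self_adjoint Pf" and Pg: "self_adjoint Pg"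
    and Pf_lower: "\<And>u. 0 \<le> sqnorm_op Pf u + 3 / 8 * sqnorm_op \<Sigma>f u"
    and Pg_lower: "\<And>v. 0 \<le> sqnorm_op Pg v + 3 / 8 * sqnorm_op \<Sigma>g v"
    and Tf: "pd (T_op \<sigma> A Pf \<Sigma>f)" and Tg: "pd (T_op \<sigma> B Pg \<Sigma>g)"
    and \<sigma>: "0 < \<sigma>" and \<tau>: "0 < \<tau>"
    and \<epsilon>: "\<And>k. 0 \<le> \<epsilon> k" "summable \<epsilon>"
    and ef: "\<And>k u. 2 * \<bar>ef k \<bullet> u\<bar> \<le> \<epsilon> k * (sqnorm_op (T_op \<sigma> A Pf \<Sigma>f) (x (Suc k) - x k)
                                           + sqnorm_op (T_op \<sigma> A Pf \<Sigma>f) u)"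
    and eg: "\<And>k v. 2 * \<bar>eg k \<bullet> v\<bar> \<le> \<epsilon> k * (sqnorm_op (T_op \<sigma> B Pg \<Sigma>g) (y (Suc k) - y k)
                                           + sqnorm_op (T_op \<sigma> B Pg \<Sigma>g) v)"
    and x_step: "\<And>k. ef k - Pf (x (Suc k) - x k) - A (z k + \<sigma> *\<^sub>R residual A B c (x (Suc k)) (y k))
                  \<in> subdiff f (x (Suc k))"
    and y_step: "\<And>k. eg k - Pg (y (Suc k) - y k) - B (z k + \<sigma> *\<^sub>R residual A B c (x (Suc k)) (y (Suc k)))
                  \<in> subdiff g (y (Suc k))"
    and z_step: "\<And>k. z (Suc k) = z k + (\<tau> * \<sigma>) *\<^sub>R residual A B c (x (Suc k)) (y (Suc k))"
begin

definition R where "R k = residual A B c (x k) (y k)"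
definition dx where "dx k = x (Suc k) - x k"
definition dy where "dy k = y (Suc k) - y k"

text \<open>The size of step \<open>k\<close>, together with the residual after it; its convergence to 0 is what makes
  cluster points satisfy the KKT conditions. The summand \<open>\<sigma> A A\<^sup>*\<close> of the x-metric is left out: on
  differences it is recovered from two residuals and the y-step.\<close>

definition step_size where
  "step_size k = sqnorm_op Pf (dx k) + sqnorm_op \<Sigma>f (dx k)
     + sqnorm_op (T_op \<sigma> B Pg \<Sigma>g) (dy k) + \<sigma> * (norm (R (Suc k)))\<^sup>2"

text \<open>Squared distance to a candidate solution in the metric adapted to the iteration. The x-block carries only \<open>Pf + \<Sigma>f\<close>, which may be degenerate; \<open>Tf_error_le\<close> restores
  control of the full norm from the residual.\<close>

definition merit where
  "merit u v w k = sqnorm_op Pf (x k - u) + sqnorm_op \<Sigma>f (x k - u)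
     + sqnorm_op (T_op \<sigma> B Pg \<Sigma>g) (y k - v) + (norm (z k - w))\<^sup>2 / (\<tau> * \<sigma>)"

lemmas Tf_eq = sqnorm_T_op[OF A, of \<sigma> Pf \<Sigma>f] and Tg_eq = sqnorm_T_op[OF B, of \<sigma> Pg \<Sigma>g]

lemma \<Sigma>_nonneg [simp]: "0 \<le> sqnorm_op \<Sigma>f u" "0 \<le> sqnorm_op \<Sigma>g v"
  by (simp_all add: psd_sqnorm_nonneg \<Sigma>f \<Sigma>g)

lemma Tg_nonneg [simp]: "0 \<le> sqnorm_op (T_op \<sigma> B Pg \<Sigma>g) v"
  by (rule psd_sqnorm_nonneg[OF pd_imp_psd[OF Tg]])

lemma Pf_\<Sigma>f_nonneg: "0 \<le> sqnorm_op Pf u + sqnorm_op \<Sigma>f u"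
  using Pf_lower[of u] \<Sigma>_nonneg(1)[of u] by linarith

lemma Tg_lower: "\<sigma> * (norm (adjoint B v))\<^sup>2 \<le> sqnorm_op (T_op \<sigma> B Pg \<Sigma>g) v"
  using Pg_lower[of v] \<Sigma>_nonneg(2)[of v] unfolding Tg_eq by argo

lemma step_size_parts:
  "0 \<le> step_size k"
  "sqnorm_op (T_op \<sigma> B Pg \<Sigma>g) (dy k) \<le> step_size k"
  "\<sigma> * (norm (R (Suc k)))\<^sup>2 \<le> step_size k"
  "\<sigma> * (norm (R (Suc k)))\<^sup>2 + \<sigma> * (norm (adjoint B (dy k)))\<^sup>2
     + (sqnorm_op Pf (dx k) + sqnorm_op \<Sigma>f (dx k)) \<le> step_size k"
proof -
  have "0 \<le> \<sigma> * (norm (R (Suc k)))\<^sup>2" using \<sigma> by simp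
  then show "0 \<le> step_size k"
      "sqnorm_op (T_op \<sigma> B Pg \<Sigma>g) (dy k) \<le> step_size k"
    "\<sigma> * (norm (R (Suc k)))\<^sup>2 \<le> step_size k"
    "\<sigma> * (norm (R (Suc k)))\<^sup>2 + \<sigma> * (norm (adjoint B (dy k)))\<^sup>2
       + (sqnorm_op Pf (dx k) + sqnorm_op \<Sigma>f (dx k)) \<le> step_size k"
    using Pf_\<Sigma>f_nonneg[of "dx k"] Tg_nonneg[of "dy k"] Tg_lower[of "dy k"]
    unfolding step_size_def by linarith+
qed

lemma merit_parts:
  "0 \<le> merit u v w k"
  "sqnorm_op (T_op \<sigma> B Pg \<Sigma>g) (y k - v) \<le> merit u v w k"
  "(norm (z k - w))\<^sup>2 / (\<tau> * \<sigma>) \<le> merit u v w k"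
  "sqnorm_op Pf (x k - u) + sqnorm_op \<Sigma>f (x k - u) + sqnorm_op (T_op \<sigma> B Pg \<Sigma>g) (y k - v) \<le> merit u v w k"
proof -
  have "0 \<le> (norm (z k - w))\<^sup>2 / (\<tau> * \<sigma>)" using \<sigma> \<tau> by simp
  then show "0 \<le> merit u v w k"
      "sqnorm_op (T_op \<sigma> B Pg \<Sigma>g) (y k - v) \<le> merit u v w k"
    "(norm (z k - w))\<^sup>2 / (\<tau> * \<sigma>) \<le> merit u v w k"
    "sqnorm_op Pf (x k - u) + sqnorm_op \<Sigma>f (x k - u) + sqnorm_op (T_op \<sigma> B Pg \<Sigma>g) (y k - v) \<le> merit u v w k"
    using Pf_\<Sigma>f_nonneg[of "x k - u"] Tg_nonneg[of "y k - v"] unfolding merit_def by linarith+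
qed

lemma A_adjoint: "A p \<bullet> u = p \<bullet> adjoint A u" and B_adjoint: "B p \<bullet> v = p \<bullet> adjoint B v"
  using adjoint_works[OF A, of p u] adjoint_works[OF B, of p v] by simp_all

lemma adjoint_A_diff: "adjoint A (u - u') = adjoint A u - adjoint A u'"
  and adjoint_B_diff: "adjoint B (v - v') = adjoint B v - adjoint B v'"
  by (simp_all add: linear_diff[OF adjoint_linear[OF A]] linear_diff[OF adjoint_linear[OF B]])

lemma kkt_residual_split:
  assumes "kkt_point f g A B c u v w"
  shows "R k = adjoint A (x k - u) + adjoint B (y k - v)"
proof -
  have "R k = R k - residual A B c u v" using assms by (simp add: kkt_point_def)
  then show ?thesis by (simp add: R_def residual_def adjoint_A_diff adjoint_B_diff)
qed

lemma residual_half_step: "residual A B c (x (Suc k)) (y k) = R (Suc k) - adjoint B (dy k)"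
  by (simp add: R_def residual_def dy_def adjoint_B_diff)

lemma norm_add_sq: "(norm (p + q))\<^sup>2 = (norm p)\<^sup>2 + 2 * (p \<bullet> q) + (norm q)\<^sup>2" for p q :: 'z
  by (simp add: power2_norm_eq_inner inner_add_left inner_add_right inner_commute)

lemma norm_diff_sq: "(norm (p - q))\<^sup>2 = (norm p)\<^sup>2 - 2 * (p \<bullet> q) + (norm q)\<^sup>2" for p q :: 'z
  by (simp add: power2_norm_eq_inner inner_diff_left inner_diff_right inner_commute)

text \<open>The fundamental estimate. Strong monotonicity of both subdifferentials between the new iterate and
  the KKT point gives, after the three-point identity for every metric and the dual update,
  a telescoping distance. Of the monotonicity gain, which is doubled, one copy of \<open>\<Sigma>f\<close> and
  \<open>\<Sigma>g\<close> at the new point completes the metric of the new \<open>merit\<close>; the other copy and the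
  one contained in the old \<open>merit\<close> together bound half of the squared step, which compensates for the indefiniteness of
  \<open>Pf\<close> and \<open>Pg\<close>. The cross term of y-step and residual has no sign.\<close>

lemma merit_step:
  assumes kkt: "kkt_point f g A B c u v w"
  shows "merit u v w (Suc k)
      + (sqnorm_op Pf (dx k) + 1 / 2 * sqnorm_op \<Sigma>f (dx k))
      + (sqnorm_op Pg (dy k) + 1 / 2 * sqnorm_op \<Sigma>g (dy k) + \<sigma> * (norm (adjoint B (dy k)))\<^sup>2)
      + (2 - \<tau>) * \<sigma> * (norm (R (Suc k)))\<^sup>2 - 2 * \<sigma> * (adjoint B (dy k) \<bullet> R (Suc k))
    \<le> merit u v w k + 2 * (ef k \<bullet> (x (Suc k) - u)) + 2 * (eg k \<bullet> (y (Suc k) - v))"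
proof -
  define a where "a = adjoint A (x (Suc k) - u)"
  define b where "b = adjoint B (y (Suc k) - v)"
  define e where "e = adjoint B (dy k)"
  define \<zeta> where "\<zeta> = z k - w"
  have R: "R (Suc k) = a + b" unfolding a_def b_def by (rule kkt_residual_split[OF kkt])
  have sf: "- A w \<in> subdiff f u" and sg: "- B w \<in> subdiff g v" using kkt by (auto simp: kkt_point_def)
  have "sqnorm_op \<Sigma>f (x (Suc k) - u)
      \<le> (ef k - Pf (dx k) - A (z k + \<sigma> *\<^sub>R (a + b - e)) - - A w) \<bullet> (x (Suc k) - u)"
    using mono_f[OF x_step[of k] sf] by (simp add: residual_half_step R e_def dx_def)
  also have "\<dots> = ef k \<bullet> (x (Suc k) - u) - Pf (dx k) \<bullet> (x (Suc k) - u) - (\<zeta> + \<sigma> *\<^sub>R (a + b - e)) \<bullet> a"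
    by (simp add: inner_add_left inner_diff_left A_adjoint a_def \<zeta>_def)
  finally have M1: "sqnorm_op \<Sigma>f (x (Suc k) - u) \<le> ef k \<bullet> (x (Suc k) - u) - Pf (dx k) \<bullet> (x (Suc k) - u)
      - (\<zeta> \<bullet> a + \<sigma> * (a \<bullet> a) + \<sigma> * (a \<bullet> b) - \<sigma> * (a \<bullet> e))"
    by (simp add: inner_add_left inner_diff_left inner_commute algebra_simps)
  have "sqnorm_op \<Sigma>g (y (Suc k) - v)
      \<le> (eg k - Pg (dy k) - B (z k + \<sigma> *\<^sub>R (a + b)) - - B w) \<bullet> (y (Suc k) - v)"
    using mono_g[OF y_step[of k] sg] by (simp add: R_def[symmetric] R dy_def)
  also have "\<dots> = eg k \<bullet> (y (Suc k) - v) - Pg (dy k) \<bullet> (y (Suc k) - v) - (\<zeta> + \<sigma> *\<^sub>R (a + b)) \<bullet> b"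
    by (simp add: inner_add_left inner_diff_left B_adjoint b_def \<zeta>_def)
  finally have M2: "sqnorm_op \<Sigma>g (y (Suc k) - v) \<le> eg k \<bullet> (y (Suc k) - v) - Pg (dy k) \<bullet> (y (Suc k) - v)
      - (\<zeta> \<bullet> b + \<sigma> * (a \<bullet> b) + \<sigma> * (b \<bullet> b))"
    by (simp add: inner_add_left inner_commute algebra_simps)
  have P1: "2 * (Pf (dx k) \<bullet> (x (Suc k) - u))
      = sqnorm_op Pf (x (Suc k) - u) - sqnorm_op Pf (x k - u) + sqnorm_op Pf (dx k)"
    unfolding dx_def by (rule three_point_identity[OF Pf])
  have P2: "2 * (Pg (dy k) \<bullet> (y (Suc k) - v))
      = sqnorm_op Pg (y (Suc k) - v) - sqnorm_op Pg (y k - v) + sqnorm_op Pg (dy k)"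
    unfolding dy_def by (rule three_point_identity[OF Pg])
  have S1: "sqnorm_op \<Sigma>f (dx k) \<le> 2 * sqnorm_op \<Sigma>f (x (Suc k) - u) + 2 * sqnorm_op \<Sigma>f (x k - u)"
    using sqnorm_op_diff_le[OF \<Sigma>f, of "x (Suc k) - u" "x k - u"] by (simp add: dx_def)
  have S2: "sqnorm_op \<Sigma>g (dy k) \<le> 2 * sqnorm_op \<Sigma>g (y (Suc k) - v) + 2 * sqnorm_op \<Sigma>g (y k - v)"
    using sqnorm_op_diff_le[OF \<Sigma>g, of "y (Suc k) - v" "y k - v"] by (simp add: dy_def)
  have "z (Suc k) - w = \<zeta> + (\<tau> * \<sigma>) *\<^sub>R (a + b)"
    using z_step[of k] by (simp add: \<zeta>_def R[symmetric] R_def)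
  then have "(norm (z (Suc k) - w))\<^sup>2 = (norm \<zeta>)\<^sup>2 + 2 * (\<tau> * \<sigma>) * (\<zeta> \<bullet> (a + b)) + (\<tau> * \<sigma>)\<^sup>2 * (norm (a + b))\<^sup>2"
    using \<sigma> \<tau> by (simp add: norm_add_sq power_mult_distrib)
  also have "\<dots> = (norm \<zeta>)\<^sup>2 + (\<tau> * \<sigma>) * (2 * (\<zeta> \<bullet> (a + b)) + \<tau> * \<sigma> * (norm (a + b))\<^sup>2)"
    by (simp add: algebra_simps power2_eq_square)
  finally have Z: "(norm (z (Suc k) - w))\<^sup>2 / (\<tau> * \<sigma>)
      = (norm \<zeta>)\<^sup>2 / (\<tau> * \<sigma>) + 2 * (\<zeta> \<bullet> a) + 2 * (\<zeta> \<bullet> b) + \<tau> * (\<sigma> * (norm (a + b))\<^sup>2)"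
    using \<sigma> \<tau> by (simp add: add_divide_distrib inner_add_right)
  have N: "\<sigma> * (norm (a + b))\<^sup>2 = \<sigma> * (a \<bullet> a) + 2 * (\<sigma> * (a \<bullet> b)) + \<sigma> * (b \<bullet> b)"
    unfolding norm_add_sq by (simp add: power2_norm_eq_inner algebra_simps)
  have By: "adjoint B (y k - v) = b - e" by (simp add: b_def e_def dy_def adjoint_B_diff)
  have N': "\<sigma> * (norm (b - e))\<^sup>2 = \<sigma> * (b \<bullet> b) - 2 * (\<sigma> * (b \<bullet> e)) + \<sigma> * (e \<bullet> e)"
    unfolding norm_diff_sq by (simp add: power2_norm_eq_inner algebra_simps)
  have X: "\<sigma> * (e \<bullet> (a + b)) = \<sigma> * (a \<bullet> e) + \<sigma> * (b \<bullet> e)"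
    by (simp add: inner_add_right inner_commute algebra_simps)
  have L: "merit u v w (Suc k) = sqnorm_op Pf (x (Suc k) - u) + sqnorm_op \<Sigma>f (x (Suc k) - u)
     + sqnorm_op Pg (y (Suc k) - v) + sqnorm_op \<Sigma>g (y (Suc k) - v) + \<sigma> * (b \<bullet> b)
     + (norm (z (Suc k) - w))\<^sup>2 / (\<tau> * \<sigma>)"
    by (simp add: merit_def Tg_eq b_def power2_norm_eq_inner)
  have L': "merit u v w k = sqnorm_op Pf (x k - u) + sqnorm_op \<Sigma>f (x k - u)
     + sqnorm_op Pg (y k - v) + sqnorm_op \<Sigma>g (y k - v) + \<sigma> * (norm (b - e))\<^sup>2
     + (norm \<zeta>)\<^sup>2 / (\<tau> * \<sigma>)"
    by (simp add: merit_def Tg_eq By \<zeta>_def)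
  have r: "(2 - \<tau>) * \<sigma> * (norm (a + b))\<^sup>2 = 2 * (\<sigma> * (norm (a + b))\<^sup>2) - \<tau> * (\<sigma> * (norm (a + b))\<^sup>2)"
    by (simp add: algebra_simps)
  have e2: "\<sigma> * (norm e)\<^sup>2 = \<sigma> * (e \<bullet> e)" "2 * \<sigma> * (e \<bullet> (a + b)) = 2 * (\<sigma> * (e \<bullet> (a + b)))"
    by (simp_all add: power2_norm_eq_inner)
  show ?thesis
    unfolding R e_def[symmetric] L L' r e2
    using M1 M2 P1 P2 S1 S2 Z N N' X by linarith
qed

text \<open>Bounds the cross term left over in \<open>merit_step\<close>: monotonicity of the subdifferential of
  \<open>g\<close> between two successive iterates replaces the new residual by the old one with
  the factor \<open>1 - \<tau>\<close>. The lower bound on \<open>Pg\<close> applied to the difference of the two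
  steps costs \<open>3/4\<close> of \<open>\<Sigma>g\<close> at either step, so the telescoping quantity is the
  nonnegative form of \<open>Pg + 3/4 \<Sigma>g\<close> and half of \<open>\<Sigma>g\<close> remains as a gain.\<close>

lemma consecutive_y_steps:
  "(sqnorm_op Pg (dy (Suc k)) + 3 / 4 * sqnorm_op \<Sigma>g (dy (Suc k))) + 1 / 2 * sqnorm_op \<Sigma>g (dy (Suc k))
      + 2 * \<sigma> * (adjoint B (dy (Suc k)) \<bullet> R (Suc (Suc k)))
    \<le> (sqnorm_op Pg (dy k) + 3 / 4 * sqnorm_op \<Sigma>g (dy k))
      + 2 * (1 - \<tau>) * \<sigma> * (adjoint B (dy (Suc k)) \<bullet> R (Suc k))
      + 2 * (eg (Suc k) \<bullet> dy (Suc k)) - 2 * (eg k \<bullet> dy (Suc k))"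
proof -
  define d where "d = dy (Suc k)"
  define e where "e = adjoint B d"
  note linP = self_adjoint_linear[OF Pg]
  have "sqnorm_op \<Sigma>g d \<le> (eg (Suc k) - Pg (dy (Suc k)) - B (z (Suc k) + \<sigma> *\<^sub>R R (Suc (Suc k)))
      - (eg k - Pg (dy k) - B (z k + \<sigma> *\<^sub>R R (Suc k)))) \<bullet> d"
    using mono_g[OF y_step[of "Suc k"] y_step[of k]] by (simp add: R_def d_def dy_def)
  also have "\<dots> = eg (Suc k) \<bullet> d - eg k \<bullet> d - Pg (d - dy k) \<bullet> d
      - (z (Suc k) + \<sigma> *\<^sub>R R (Suc (Suc k)) - (z k + \<sigma> *\<^sub>R R (Suc k))) \<bullet> e"
    by (simp only: inner_diff_left B_adjoint e_def[symmetric] linear_diff[OF linP] d_def[symmetric])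
  also have "z (Suc k) + \<sigma> *\<^sub>R R (Suc (Suc k)) - (z k + \<sigma> *\<^sub>R R (Suc k))
      = \<sigma> *\<^sub>R R (Suc (Suc k)) - ((1 - \<tau>) * \<sigma>) *\<^sub>R R (Suc k)"
    using z_step[of k] by (simp add: R_def[symmetric] algebra_simps)
  finally have M: "sqnorm_op \<Sigma>g d \<le> eg (Suc k) \<bullet> d - eg k \<bullet> d - Pg (d - dy k) \<bullet> d
      - \<sigma> * (e \<bullet> R (Suc (Suc k))) + (1 - \<tau>) * \<sigma> * (e \<bullet> R (Suc k))"
    by (simp add: inner_diff_left inner_diff_right inner_commute)
  have T: "2 * (Pg (d - dy k) \<bullet> d) = sqnorm_op Pg d - sqnorm_op Pg (dy k) + sqnorm_op Pg (d - dy k)"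
    using three_point_identity[OF Pg, of d "dy k" 0] by simp
  have S: "sqnorm_op \<Sigma>g (d - dy k) \<le> 2 * sqnorm_op \<Sigma>g d + 2 * sqnorm_op \<Sigma>g (dy k)"
    by (rule sqnorm_op_diff_le[OF \<Sigma>g])
  have "2 * \<sigma> * (e \<bullet> R (Suc (Suc k))) = 2 * (\<sigma> * (e \<bullet> R (Suc (Suc k))))"
    "2 * (1 - \<tau>) * \<sigma> * (e \<bullet> R (Suc k)) = 2 * ((1 - \<tau>) * \<sigma> * (e \<bullet> R (Suc k)))"
    by simp_all
  then show ?thesis
    using M T S Pg_lower[of "d - dy k"] unfolding d_def[symmetric] e_def[symmetric] by argo
qed

text \<open>The missing part \<open>adjoint A (x - u)\<close> of the norm is the residual minus
  \<open>adjoint B (y - v)\<close>.\<close>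

lemma Tf_error_le:
  assumes "kkt_point f g A B c u v w"
  shows "sqnorm_op (T_op \<sigma> A Pf \<Sigma>f) (x (Suc k) - u) \<le> 2 * (merit u v w (Suc k) + step_size k)"
proof -
  let ?r = "R (Suc k)" and ?b = "adjoint B (y (Suc k) - v)"
  have "adjoint A (x (Suc k) - u) = ?r - ?b" using kkt_residual_split[OF assms, of "Suc k"] by simp
  then have "(norm (adjoint A (x (Suc k) - u)))\<^sup>2 \<le> 2 * (norm ?r)\<^sup>2 + 2 * (norm ?b)\<^sup>2"
    using zero_le_power2[of "norm (?r + ?b)"] by (simp add: norm_add_sq norm_diff_sq)
  then have "\<sigma> * (norm (adjoint A (x (Suc k) - u)))\<^sup>2 \<le> \<sigma> * (2 * (norm ?r)\<^sup>2 + 2 * (norm ?b)\<^sup>2)"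
    using \<sigma> by (intro mult_left_mono) auto
  also have "\<dots> = 2 * (\<sigma> * (norm ?r)\<^sup>2) + 2 * (\<sigma> * (norm ?b)\<^sup>2)" by (simp add: algebra_simps)
  finally show ?thesis
    using Tg_lower[of "y (Suc k) - v"] merit_parts(4)[of "Suc k" u v w] step_size_parts(3)[of k]
      Pf_\<Sigma>f_nonneg[of "x (Suc k) - u"]
    unfolding Tf_eq by argo
qed

lemma Tf_step_le: "sqnorm_op (T_op \<sigma> A Pf \<Sigma>f) (dx (Suc k)) \<le> 3 * (step_size (Suc k) + step_size k)"
proof -
  let ?r = "R (Suc (Suc k))" and ?s = "R (Suc k)" and ?b = "adjoint B (dy (Suc k))"
  have eq: "adjoint A (dx (Suc k)) = (?r - ?s) - ?b"
    by (simp add: R_def residual_def dx_def dy_def adjoint_A_diff adjoint_B_diff)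
  have "(norm ((?r - ?s) - ?b))\<^sup>2 \<le> 3 * (norm ?r)\<^sup>2 + 3 * (norm ?s)\<^sup>2 + 3 * (norm ?b)\<^sup>2"
    using zero_le_power2[of "norm (?r + ?s)"] zero_le_power2[of "norm (?r + ?b)"]
      zero_le_power2[of "norm (?s - ?b)"]
    by (simp add: norm_add_sq norm_diff_sq inner_diff_left)
  then have "\<sigma> * (norm (adjoint A (dx (Suc k))))\<^sup>2 \<le> \<sigma> * (3 * (norm ?r)\<^sup>2 + 3 * (norm ?s)\<^sup>2 + 3 * (norm ?b)\<^sup>2)"
    unfolding eq using \<sigma> by (intro mult_left_mono) auto
  also have "\<dots> = 3 * (\<sigma> * (norm ?r)\<^sup>2) + 3 * (\<sigma> * (norm ?s)\<^sup>2) + 3 * (\<sigma> * (norm ?b)\<^sup>2)"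
    by (simp add: algebra_simps)
  finally show ?thesis
    using step_size_parts(4)[of "Suc k"] step_size_parts(3)[of k] Pf_\<Sigma>f_nonneg[of "dx (Suc k)"]
    unfolding Tf_eq by argo
qed

lemma error_terms_le:
  assumes kkt: "kkt_point f g A B c u v w"
  shows "2 * (ef (Suc k) \<bullet> (x (Suc (Suc k)) - u)) + 2 * (eg (Suc k) \<bullet> (y (Suc (Suc k)) - v))
      + 2 * \<bar>eg (Suc k) \<bullet> dy (Suc k)\<bar> + 2 * \<bar>eg k \<bullet> dy (Suc k)\<bar>
    \<le> 8 * (\<epsilon> k + \<epsilon> (Suc k)) * (merit u v w (Suc (Suc k)) + step_size (Suc k) + step_size k)"
proof -
  let ?m = "merit u v w (Suc (Suc k))" and ?D = "step_size (Suc k)" and ?D' = "step_size k"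
  let ?E = "?m + ?D + ?D'"
  let ?T = "sqnorm_op (T_op \<sigma> A Pf \<Sigma>f)" and ?S = "sqnorm_op (T_op \<sigma> B Pg \<Sigma>g)"
  note pos = merit_parts(1)[of u v w "Suc (Suc k)"] step_size_parts(1)[of k] step_size_parts(1)[of "Suc k"]
  note dyp = step_size_parts(2)[of k] step_size_parts(2)[of "Suc k"]
  have "2 * (ef (Suc k) \<bullet> (x (Suc (Suc k)) - u)) \<le> 2 * \<bar>ef (Suc k) \<bullet> (x (Suc (Suc k)) - u)\<bar>" by simp
  also have "\<dots> \<le> \<epsilon> (Suc k) * (?T (dx (Suc k)) + ?T (x (Suc (Suc k)) - u))"
    unfolding dx_def by (rule ef)
  also have "\<dots> \<le> \<epsilon> (Suc k) * (5 * ?E)"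
    using Tf_step_le[of k] Tf_error_le[OF kkt, of "Suc k"] pos by (intro mult_left_mono \<epsilon>) argo
  finally have 1: "2 * (ef (Suc k) \<bullet> (x (Suc (Suc k)) - u)) \<le> 5 * (\<epsilon> (Suc k) * ?E)"
    by (simp only: mult.left_commute)
  have "2 * (eg (Suc k) \<bullet> (y (Suc (Suc k)) - v)) \<le> 2 * \<bar>eg (Suc k) \<bullet> (y (Suc (Suc k)) - v)\<bar>" by simp
  also have "\<dots> \<le> \<epsilon> (Suc k) * (?S (dy (Suc k)) + ?S (y (Suc (Suc k)) - v))"
    unfolding dy_def by (rule eg)
  also have "\<dots> \<le> \<epsilon> (Suc k) * ?E"
    using dyp merit_parts(2)[of "Suc (Suc k)" v u w] pos by (intro mult_left_mono \<epsilon>) argo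
  finally have 2: "2 * (eg (Suc k) \<bullet> (y (Suc (Suc k)) - v)) \<le> \<epsilon> (Suc k) * ?E" .
  have "2 * \<bar>eg (Suc k) \<bullet> dy (Suc k)\<bar> \<le> \<epsilon> (Suc k) * (?S (dy (Suc k)) + ?S (dy (Suc k)))"
    using eg[of "Suc k" "dy (Suc k)"] by (simp add: dy_def)
  also have "\<dots> \<le> \<epsilon> (Suc k) * (2 * ?E)" using dyp pos by (intro mult_left_mono \<epsilon>) argo
  finally have 3: "2 * \<bar>eg (Suc k) \<bullet> dy (Suc k)\<bar> \<le> 2 * (\<epsilon> (Suc k) * ?E)"
    by (simp only: mult.left_commute)
  have "2 * \<bar>eg k \<bullet> dy (Suc k)\<bar> \<le> \<epsilon> k * (?S (dy k) + ?S (dy (Suc k)))"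
    using eg[of k "dy (Suc k)"] by (simp add: dy_def)
  also have "\<dots> \<le> \<epsilon> k * ?E" using dyp pos by (intro mult_left_mono \<epsilon>) argo
  finally have 4: "2 * \<bar>eg k \<bullet> dy (Suc k)\<bar> \<le> \<epsilon> k * ?E" .
  have "0 \<le> \<epsilon> k * ?E" using \<epsilon>(1) pos by (intro mult_nonneg_nonneg) auto
  moreover have "8 * (\<epsilon> k + \<epsilon> (Suc k)) * ?E = 8 * (\<epsilon> k * ?E) + 8 * (\<epsilon> (Suc k) * ?E)"
    by (simp add: algebra_simps)
  ultimately show ?thesis using 1 2 3 4 by linarith
qed

lemma error_weights: "summable (\<lambda>k. 8 * (\<epsilon> k + \<epsilon> (Suc k)))" "0 \<le> 8 * (\<epsilon> k + \<epsilon> (Suc k))"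
  using \<epsilon> by (auto intro!: summable_mult summable_add simp: summable_Suc_iff)

text \<open>From \<open>Pf \<ge> -3/8 \<Sigma>f\<close>: \<open>\<Sigma>f\<close> is at most 8 times \<open>Pf + 1/2 \<Sigma>f\<close>, whence
  the factor \<open>1 + 8/2 = 5\<close>.\<close>

lemma x_decrease: "1 / 5 * (sqnorm_op Pf u + sqnorm_op \<Sigma>f u) \<le> sqnorm_op Pf u + 1 / 2 * sqnorm_op \<Sigma>f u"
  using Pf_lower[of u] \<Sigma>_nonneg(1)[of u] by argo

text \<open>The cross term with the old residual is split by Young's inequality with a weight \<open>s\<close>. The
  y-step absorbs its share if \<open>\<bar>1 - \<tau>\<bar> < s\<close>, and the residual terms telescope with a net
  decrease if \<open>\<bar>1 - \<tau>\<bar> * s < 2 - \<tau>\<close>. Such an \<open>s\<close> exists exactly if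
  \<open>(1 - \<tau>)\<^sup>2 < 2 - \<tau>\<close>, that is \<open>\<tau>\<^sup>2 < 1 + \<tau>\<close>, which is where the golden ratio
  comes from.\<close>

lemma descent_small_dual_step:
  assumes kkt: "kkt_point f g A B c u v w" and \<tau>_small: "\<tau> < (1 + sqrt 5) / 2"
  shows "convergent (merit u v w)" and "step_size \<longlonglongrightarrow> 0"
proof -
  define m where "m = \<bar>1 - \<tau>\<bar>"
  have "sqrt 5 < 3" by (rule real_less_lsqrt) auto
  then have \<tau>2: "\<tau> < 2" using \<tau>_small by argo
  have gold: "\<tau>\<^sup>2 < 1 + \<tau>"
  proof -
    have "1 < sqrt (5::real)" by simp
    then have "2 * \<tau> - 1 < sqrt 5" "- (2 * \<tau> - 1) < sqrt 5"
      using \<tau>_small \<tau> by argo+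
    then have "\<bar>2 * \<tau> - 1\<bar> < sqrt 5" by simp
    then have "(2 * \<tau> - 1)\<^sup>2 < 5" using real_sqrt_less_iff[of "(2 * \<tau> - 1)\<^sup>2" 5] by simp
    then show ?thesis by (simp add: power2_eq_square algebra_simps)
  qed
  \<comment> \<open>half of the gap \<open>2 - \<tau> - m\<^sup>2\<close>; since \<open>m < 1\<close> this leaves \<open>m * (m + h)\<close> below \<open>2 - \<tau>\<close>\<close>
  define h where "h = (1 + \<tau> - \<tau>\<^sup>2) / 2"
  define s where "s = m + h"
  have h: "h > 0" using gold by (simp add: h_def)
  have m: "0 \<le> m" "m < 1" using \<tau> \<tau>2 by (auto simp: m_def)
  have s: "m < s" using h by (simp add: s_def)
  have mm: "m * m = 1 - 2 * \<tau> + \<tau>\<^sup>2"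
    by (simp add: m_def power2_eq_square algebra_simps flip: abs_mult)
  have "m * h < h * 2" using m h mult_strict_right_mono[of m 2 h] by simp
  then have ms: "m * s < 2 - \<tau>" unfolding s_def using mm by (simp add: distrib_left h_def)
  define W where "W k = sqnorm_op Pg (dy k) + 3 / 4 * sqnorm_op \<Sigma>g (dy k)" for k
  define \<Phi> where "\<Phi> k = merit u v w (Suc k) + W k + m * s * (\<sigma> * (norm (R (Suc k)))\<^sup>2)" for k
  define \<delta> where "\<delta> = min (1 / 5) (min (2 - \<tau> - m * s) (1 - m / s))"
  have s0: "0 < s" using s m by simp
  have \<delta>: "0 < \<delta>" using ms s s0 by (simp add: \<delta>_def)
  have \<delta>_le: "\<delta> \<le> 1 / 5" "\<delta> \<le> 2 - \<tau> - m * s" "\<delta> \<le> 1 - m / s" "\<delta> \<le> 1"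
    unfolding \<delta>_def by linarith+
  have W: "0 \<le> W k" "W k \<le> step_size k" for k
  proof -
    have "0 \<le> \<sigma> * (norm (adjoint B (dy k)))\<^sup>2" using \<sigma> by simp
    then show "0 \<le> W k" "W k \<le> step_size k"
      using Pg_lower[of "dy k"] \<Sigma>_nonneg(2)[of "dy k"] step_size_parts(2)[of k]
      unfolding W_def Tg_eq by argo+
  qed
  have ms0: "0 \<le> m * s" using m s0 by simp
  have R0: "0 \<le> \<sigma> * (norm (R k))\<^sup>2" for k using \<sigma> by simp
  have \<Phi>_ge: "merit u v w (Suc k) \<le> \<Phi> k" for k
    using W(1)[of k] mult_nonneg_nonneg[OF ms0 R0[of "Suc k"]] unfolding \<Phi>_def by linarith
  have \<Phi>_step: "\<Phi> (Suc k) \<le> \<Phi> k - \<delta> * step_size (Suc k) + 0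
      + 8 * (\<epsilon> k + \<epsilon> (Suc k)) * (\<Phi> (Suc k) + step_size (Suc k) + step_size k)" for k
  proof -
    let ?d = "dy (Suc k)" and ?r = "R (Suc (Suc k))" and ?r' = "R (Suc k)"
    let ?b = "adjoint B ?d"
    let ?e = "8 * (\<epsilon> k + \<epsilon> (Suc k))"
    define rr where "rr = \<sigma> * (norm ?r)\<^sup>2"
    define rr' where "rr' = \<sigma> * (norm ?r')\<^sup>2"
    define bb where "bb = \<sigma> * (norm ?b)\<^sup>2"
    define pf where "pf = sqnorm_op Pf (dx (Suc k))"
    define sf where "sf = sqnorm_op \<Sigma>f (dx (Suc k))"
    define pg where "pg = sqnorm_op Pg ?d"
    define sg where "sg = sqnorm_op \<Sigma>g ?d"
    have "2 * (1 - \<tau>) * (?b \<bullet> ?r') \<le> 2 * m * (norm ?b * norm ?r')"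
    proof -
      have "(1 - \<tau>) * (?b \<bullet> ?r') \<le> m * \<bar>?b \<bullet> ?r'\<bar>" unfolding m_def
        by (metis abs_ge_self abs_mult)
      also have "\<dots> \<le> m * (norm ?b * norm ?r')" by (intro mult_left_mono Cauchy_Schwarz_ineq2 m)
      finally have "2 * ((1 - \<tau>) * (?b \<bullet> ?r')) \<le> 2 * (m * (norm ?b * norm ?r'))" by (rule mult_left_mono) simp
      then show ?thesis by (simp only: mult.assoc)
    qed
    also have "2 * m * (norm ?b * norm ?r') \<le> m * (s * (norm ?r')\<^sup>2 + (norm ?b)\<^sup>2 / s)"
    proof -
      have "0 \<le> (s * norm ?r' - norm ?b)\<^sup>2 / s" using s0 by simp
      also have "\<dots> = s * (norm ?r')\<^sup>2 + (norm ?b)\<^sup>2 / s - 2 * (norm ?b * norm ?r')"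
        using s0 by (simp add: power2_eq_square field_simps)
      finally show ?thesis using mult_left_mono[OF _ m(1)] by (simp add: mult.assoc mult.left_commute)
    qed
    finally have "\<sigma> * (2 * (1 - \<tau>) * (?b \<bullet> ?r')) \<le> \<sigma> * (m * (s * (norm ?r')\<^sup>2 + (norm ?b)\<^sup>2 / s))"
      using \<sigma> by (intro mult_left_mono) auto
    then have cross: "2 * (1 - \<tau>) * \<sigma> * (?b \<bullet> ?r') \<le> m * s * rr' + m / s * bb"
      by (simp add: rr'_def bb_def algebra_simps)
    have err: "2 * (ef (Suc k) \<bullet> (x (Suc (Suc k)) - u)) + 2 * (eg (Suc k) \<bullet> (y (Suc (Suc k)) - v))
        + 2 * \<bar>eg (Suc k) \<bullet> ?d\<bar> + 2 * \<bar>eg k \<bullet> ?d\<bar>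
        \<le> ?e * (\<Phi> (Suc k) + step_size (Suc k) + step_size k)" (is "?err \<le> _")
      using \<Phi>_ge[of "Suc k"] error_weights(2)[of k]
      by (intro order_trans[OF error_terms_le[OF kkt]] mult_left_mono) auto
    have dec: "\<delta> * step_size (Suc k)
        \<le> (pf + 1 / 2 * sf) + (pg + sg + (1 - m / s) * bb) + (2 - \<tau> - m * s) * rr"
    proof -
      have "\<delta> * (pf + sf) \<le> 1 / 5 * (pf + sf)"
        unfolding pf_def sf_def by (intro mult_right_mono Pf_\<Sigma>f_nonneg \<delta>_le)
      also have "\<dots> \<le> pf + 1 / 2 * sf" unfolding pf_def sf_def by (rule x_decrease)
      finally have 1: "\<delta> * (pf + sf) \<le> pf + 1 / 2 * sf" .
      have "0 \<le> pg + sg"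
        using Pg_lower[of ?d] \<Sigma>_nonneg(2)[of ?d] unfolding pg_def sg_def by linarith
      then have 2: "\<delta> * (pg + sg) \<le> 1 * (pg + sg)" by (intro mult_right_mono \<delta>_le)
      have 3: "\<delta> * bb \<le> (1 - m / s) * bb" using \<sigma> by (intro mult_right_mono \<delta>_le) (simp add: bb_def)
      have 4: "\<delta> * rr \<le> (2 - \<tau> - m * s) * rr" using \<sigma> by (intro mult_right_mono \<delta>_le) (simp add: rr_def)
      have "step_size (Suc k) = (pf + sf) + (pg + sg) + bb + rr"
        by (simp add: step_size_def Tg_eq pf_def sf_def pg_def sg_def bb_def rr_def)
      then show ?thesis using 1 2 3 4 by (simp add: distrib_left)
    qed
    have e1: "(1 - m / s) * bb = bb - m / s * bb" "(2 - \<tau> - m * s) * rr = (2 - \<tau>) * rr - m * s * rr"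
      by (simp_all add: left_diff_distrib)
    have step1: "merit u v w (Suc (Suc k)) + (pf + 1 / 2 * sf) + (pg + 1 / 2 * sg + bb) + (2 - \<tau>) * rr
        - 2 * \<sigma> * (?b \<bullet> ?r)
      \<le> merit u v w (Suc k) + 2 * (ef (Suc k) \<bullet> (x (Suc (Suc k)) - u)) + 2 * (eg (Suc k) \<bullet> (y (Suc (Suc k)) - v))"
      using merit_step[OF kkt, of "Suc k"] by (simp add: pf_def sf_def pg_def sg_def bb_def rr_def mult.assoc)
    have step2: "W (Suc k) + 1 / 2 * sg + 2 * \<sigma> * (?b \<bullet> ?r)
      \<le> W k + 2 * (1 - \<tau>) * \<sigma> * (?b \<bullet> ?r') + 2 * \<bar>eg (Suc k) \<bullet> ?d\<bar> + 2 * \<bar>eg k \<bullet> ?d\<bar>"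
      using consecutive_y_steps[of k] unfolding W_def sg_def by linarith
    have "\<Phi> (Suc k) = merit u v w (Suc (Suc k)) + W (Suc k) + m * s * rr"
      "\<Phi> k = merit u v w (Suc k) + W k + m * s * rr'"
      by (simp_all add: \<Phi>_def rr_def rr'_def)
    then show ?thesis using step1 step2 cross err dec unfolding e1 by linarith
  qed
  have \<Phi>0: "0 \<le> \<Phi> k" for k using \<Phi>_ge[of k] merit_parts(1)[of u v w "Suc k"] by linarith
  note conv = perturbed_descent_convergence[where a = \<Phi> and b = "\<lambda>_. 0" and D = step_size and d = \<delta>
      and \<epsilon> = "\<lambda>k. 8 * (\<epsilon> k + \<epsilon> (Suc k))", OF \<Phi>0 order_refl step_size_parts(1) error_weights(2) \<delta>
      summable_zero error_weights(1) \<Phi>_step]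
  show D: "step_size \<longlonglongrightarrow> 0" by (rule conv(2))
  have "W \<longlonglongrightarrow> 0" using W D by (intro tendsto_sandwich[OF _ _ tendsto_const D]) auto
  moreover have "(\<lambda>k. \<sigma> * (norm (R (Suc k)))\<^sup>2) \<longlonglongrightarrow> 0"
    using step_size_parts(3) R0 D by (intro tendsto_sandwich[OF _ _ tendsto_const D]) auto
  ultimately have "(\<lambda>k. W k + m * s * (\<sigma> * (norm (R (Suc k)))\<^sup>2)) \<longlonglongrightarrow> 0 + m * s * 0"
    by (intro tendsto_intros)
  then have "convergent (\<lambda>k. \<Phi> k - (W k + m * s * (\<sigma> * (norm (R (Suc k)))\<^sup>2)))"
    using conv(1) by (intro convergent_diff) (auto intro: convergentI)
  then have "convergent (\<lambda>k. merit u v w (Suc k))" by (simp add: \<Phi>_def)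
  then show "convergent (merit u v w)" by (simp add: convergent_Suc_iff)
qed

text \<open>For larger dual steps the cross term is not absorbed by the decrease; the summability hypothesis
  makes it a summable perturbation instead.\<close>

lemma descent_large_dual_step:
  assumes kkt: "kkt_point f g A B c u v w" and \<tau>2: "\<tau> < 2"
    and sum: "summable (\<lambda>k. 10 * \<sigma> / \<tau> * (norm (R k))\<^sup>2 + sqnorm_op (T_op \<sigma> B Pg \<Sigma>g) (dy k))"
  shows "convergent (merit u v w)" and "step_size \<longlonglongrightarrow> 0"
proof -
  define S where "S k = 10 * \<sigma> / \<tau> * (norm (R k))\<^sup>2 + sqnorm_op (T_op \<sigma> B Pg \<Sigma>g) (dy k)" for k
  have S: "0 \<le> S k" "\<sigma> * (norm (R k))\<^sup>2 \<le> S k" "sqnorm_op (T_op \<sigma> B Pg \<Sigma>g) (dy k) \<le> S k" for k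
  proof -
    have "\<sigma> * (norm (R k))\<^sup>2 * \<tau> \<le> \<sigma> * (norm (R k))\<^sup>2 * 10" using \<tau>2 \<sigma> by (intro mult_left_mono) auto
    then have 1: "\<sigma> * (norm (R k))\<^sup>2 \<le> 10 * \<sigma> / \<tau> * (norm (R k))\<^sup>2" using \<tau> by (simp add: field_simps)
    have "0 \<le> \<sigma> * (norm (R k))\<^sup>2" using \<sigma> by simp
    then show "0 \<le> S k" "\<sigma> * (norm (R k))\<^sup>2 \<le> S k" "sqnorm_op (T_op \<sigma> B Pg \<Sigma>g) (dy k) \<le> S k"
      using 1 Tg_nonneg[of "dy k"] unfolding S_def by linarith+
  qed
  \<comment> \<open>one copy pays for the cross term, the other restores the y-step and the residual inside
    \<open>step_size (Suc k)\<close>\<close>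
  define b where "b k = 2 * (S (Suc k) + S (Suc (Suc k)))" for k
  have b: "summable b" "0 \<le> b k" for k
    using sum S(1) unfolding b_def S_def[symmetric]
    by (auto intro!: summable_mult summable_add simp: summable_Suc_iff[of S]
        summable_Suc_iff[of "\<lambda>k. S (Suc k)"])
  have m_step: "merit u v w (Suc (Suc k)) \<le> merit u v w (Suc k) - 1 / 5 * step_size (Suc k) + b k
      + 8 * (\<epsilon> k + \<epsilon> (Suc k)) * (merit u v w (Suc (Suc k)) + step_size (Suc k) + step_size k)" for k
  proof -
    let ?d = "dy (Suc k)" and ?r = "R (Suc (Suc k))"
    let ?b = "adjoint B ?d"
    have "2 * (?b \<bullet> ?r) \<le> (norm ?b)\<^sup>2 + (norm ?r)\<^sup>2"
      using zero_le_power2[of "norm (?b - ?r)"] by (simp add: norm_diff_sq)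
    then have "\<sigma> * (2 * (?b \<bullet> ?r)) \<le> \<sigma> * ((norm ?b)\<^sup>2 + (norm ?r)\<^sup>2)"
      using \<sigma> by (intro mult_left_mono) auto
    then have cross: "2 * \<sigma> * (?b \<bullet> ?r) \<le> \<sigma> * (norm ?b)\<^sup>2 + \<sigma> * (norm ?r)\<^sup>2"
      by (simp add: algebra_simps)
    have pos: "0 \<le> (2 - \<tau>) * \<sigma> * (norm ?r)\<^sup>2" "0 \<le> \<bar>eg (Suc k) \<bullet> ?d\<bar>" "0 \<le> \<bar>eg k \<bullet> ?d\<bar>"
      using \<tau>2 \<sigma> by auto
    have "0 \<le> sqnorm_op Pg ?d + 1 / 2 * sqnorm_op \<Sigma>g ?d"
      using Pg_lower[of ?d] \<Sigma>_nonneg(2)[of ?d] by argo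
    then show ?thesis
      using merit_step[OF kkt, of "Suc k"] error_terms_le[OF kkt, of k] cross pos
        x_decrease[of "dx (Suc k)"] S(2)[of "Suc (Suc k)"] S(3)[of "Suc k"] S(1)[of "Suc k"]
        S(1)[of "Suc (Suc k)"]
      unfolding step_size_def[of "Suc k"] b_def by argo
  qed
  note conv = perturbed_descent_convergence[where a = "\<lambda>k. merit u v w (Suc k)" and b = b
      and D = step_size and d = "1 / 5" and \<epsilon> = "\<lambda>k. 8 * (\<epsilon> k + \<epsilon> (Suc k))",
      OF merit_parts(1) b(2) step_size_parts(1) error_weights(2) _ b(1) error_weights(1) m_step]
  show "step_size \<longlonglongrightarrow> 0" by (rule conv(2)) simp
  have "convergent (\<lambda>k. merit u v w (Suc k))" by (rule conv(1)) simp
  then show "convergent (merit u v w)" by (simp add: convergent_Suc_iff)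
qed

end

section \<open>Convergence of the whole sequence\<close>

lemma tendsto_linear:
  fixes L :: "'q::euclidean_space \<Rightarrow> 'p::euclidean_space"
  assumes "linear L" and "h \<longlonglongrightarrow> t"
  shows "(\<lambda>j. L (h j)) \<longlonglongrightarrow> L t"
  using bounded_linear.tendsto[OF _ assms(2)] assms(1) by (simp add: linear_conv_bounded_linear)

lemma tendsto_sqnorm_op_diff:
  fixes T :: "'q::euclidean_space \<Rightarrow> 'q"
  assumes "linear T" and "h \<longlonglongrightarrow> t"
  shows "(\<lambda>j. sqnorm_op T (h j - t)) \<longlonglongrightarrow> 0"
proof -
  have "(\<lambda>j. h j - t) \<longlonglongrightarrow> 0" using assms(2) by (simp add: LIM_zero)
  then have "(\<lambda>j. (h j - t) \<bullet> T (h j - t)) \<longlonglongrightarrow> 0 \<bullet> T 0"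
    by (intro tendsto_inner tendsto_linear[OF assms(1)])
  then show ?thesis by (simp add: sqnorm_op_def)
qed

context inexact_admm
begin

text \<open>Opial-type argument: convergence of the merit function for every KKT point bounds the iterates;
  vanishing steps make a cluster point satisfy the KKT conditions, because the subdifferentials
  have closed graphs; and the merit function of this particular point converges and tends to 0
  along a subsequence, hence tends to 0.\<close>

lemma inexact_iterates_converge:
  assumes ex: "\<exists>u v w. kkt_point f g A B c u v w"
    and merit_conv: "\<And>u v w. kkt_point f g A B c u v w \<Longrightarrow> convergent (merit u v w)"
    and D: "step_size \<longlonglongrightarrow> 0"
  obtains u v w where "kkt_point f g A B c u v w" "x \<longlonglongrightarrow> u" "y \<longlonglongrightarrow> v" "z \<longlonglongrightarrow> w"
proof -
  have D': "(\<lambda>k. step_size (Suc k)) \<longlonglongrightarrow> 0" by (rule LIMSEQ_Suc[OF D])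
  have sqz: "h \<longlonglongrightarrow> 0" if "\<And>k. 0 \<le> h k" "\<And>k. h k \<le> H k" "H \<longlonglongrightarrow> 0" for h H :: "nat \<Rightarrow> real"
    using that by (intro tendsto_sandwich[of "\<lambda>_. 0" h sequentially H 0]) auto
  have Tf0: "0 \<le> sqnorm_op (T_op \<sigma> A Pf \<Sigma>f) p" for p by (rule psd_sqnorm_nonneg[OF pd_imp_psd[OF Tf]])
  \<comment> \<open>the bound on the x-step involves the residuals before and after it, hence the shifted index\<close>
  have dxT: "(\<lambda>k. sqnorm_op (T_op \<sigma> A Pf \<Sigma>f) (dx (Suc k))) \<longlonglongrightarrow> 0"
    using tendsto_mult_right_zero[OF tendsto_add_zero[OF D' D], of 3]
    by (intro sqz[OF Tf0 Tf_step_le]) simp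
  then have "(\<lambda>k. dx (Suc k)) \<longlonglongrightarrow> 0" by (rule pd_sqnorm_tendsto_zero[OF Tf])
  then have dx0: "dx \<longlonglongrightarrow> 0" by (rule LIMSEQ_imp_Suc)
  have dyT: "(\<lambda>k. sqnorm_op (T_op \<sigma> B Pg \<Sigma>g) (dy k)) \<longlonglongrightarrow> 0"
    by (rule sqz[OF Tg_nonneg step_size_parts(2) D])
  then have dy0: "dy \<longlonglongrightarrow> 0" by (rule pd_sqnorm_tendsto_zero[OF Tg])
  have "(\<lambda>k. \<sigma> * (norm (R (Suc k)))\<^sup>2) \<longlonglongrightarrow> 0"
    by (rule sqz[OF _ step_size_parts(3) D]) (use \<sigma> in simp)
  then have "(\<lambda>k. (norm (R (Suc k)))\<^sup>2) \<longlonglongrightarrow> 0" using \<sigma> by (simp add: tendsto_mult_left_iff[of \<sigma> _ 0, simplified])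
  then have R0: "(\<lambda>k. R (Suc k)) \<longlonglongrightarrow> 0"
    using tendsto_real_sqrt[of "\<lambda>k. (norm (R (Suc k)))\<^sup>2" 0 sequentially] by (simp add: tendsto_norm_zero_iff)
  have \<epsilon>0: "\<epsilon> \<longlonglongrightarrow> 0" by (rule summable_LIMSEQ_zero[OF \<epsilon>(2)])
  have "(\<lambda>k. ef (Suc k)) \<longlonglongrightarrow> 0"
  proof (subst tendsto_componentwise_iff, intro ballI)
    fix i :: 'x
    let ?H = "\<lambda>k. \<epsilon> (Suc k) * (sqnorm_op (T_op \<sigma> A Pf \<Sigma>f) (dx (Suc k)) + sqnorm_op (T_op \<sigma> A Pf \<Sigma>f) i)"
    have "?H \<longlonglongrightarrow> 0 * (0 + sqnorm_op (T_op \<sigma> A Pf \<Sigma>f) i)"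
      by (intro tendsto_intros LIMSEQ_Suc[OF \<epsilon>0] dxT)
    moreover have "norm (ef (Suc k) \<bullet> i) \<le> ?H k" for k using ef[of "Suc k" i] by (simp add: dx_def)
    ultimately show "(\<lambda>k. ef (Suc k) \<bullet> i) \<longlonglongrightarrow> 0 \<bullet> i"
      using Lim_null_comparison[where f = "\<lambda>k. ef (Suc k) \<bullet> i" and g = ?H and net = sequentially] by simp
  qed
  then have ef0: "ef \<longlonglongrightarrow> 0" by (rule LIMSEQ_imp_Suc)
  have eg0: "eg \<longlonglongrightarrow> 0"
  proof (subst tendsto_componentwise_iff, intro ballI)
    fix i :: 'y
    let ?H = "\<lambda>k. \<epsilon> k * (sqnorm_op (T_op \<sigma> B Pg \<Sigma>g) (dy k) + sqnorm_op (T_op \<sigma> B Pg \<Sigma>g) i)"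
    have "?H \<longlonglongrightarrow> 0 * (0 + sqnorm_op (T_op \<sigma> B Pg \<Sigma>g) i)"
      by (intro tendsto_intros \<epsilon>0 dyT)
    moreover have "norm (eg k \<bullet> i) \<le> ?H k" for k using eg[of k i] by (simp add: dy_def)
    ultimately show "(\<lambda>k. eg k \<bullet> i) \<longlonglongrightarrow> 0 \<bullet> i"
      using Lim_null_comparison[where f = "\<lambda>k. eg k \<bullet> i" and g = ?H and net = sequentially] by simp
  qed
  let ?p = "\<lambda>k. (x (Suc k), y (Suc k), z (Suc k))"
  have "bounded (range ?p)"
  proof -
    obtain u v w where kkt: "kkt_point f g A B c u v w" using ex by blast
    obtain M where M: "\<And>k. norm (merit u v w k) \<le> M"
      using convergent_imp_Bseq[OF merit_conv[OF kkt]] by (auto simp: Bseq_def)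
    obtain N where N: "\<And>k. norm (step_size k) \<le> N"
      using convergent_imp_Bseq[OF convergentI[OF D]] by (auto simp: Bseq_def)
    have m: "merit u v w k \<le> M" and n: "step_size k \<le> N" for k using M[of k] N[of k] by auto
    have "bounded (range (\<lambda>k. x (Suc k) - u))"
    proof (rule pd_sqnorm_bounded[OF Tf])
      show "sqnorm_op (T_op \<sigma> A Pf \<Sigma>f) (x (Suc k) - u) \<le> 2 * (M + N)" for k
        using Tf_error_le[OF kkt, of k] m[of "Suc k"] n[of k] by simp
    qed
    moreover have "bounded (range (\<lambda>k. y (Suc k) - v))"
      by (rule pd_sqnorm_bounded[OF Tg, of _ M]) (rule order_trans[OF merit_parts(2) m])
    moreover have "bounded (range (\<lambda>k. z (Suc k) - w))"
    proof -
      have "norm (z (Suc k) - w) \<le> sqrt (M * (\<tau> * \<sigma>))" for k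
        using order_trans[OF merit_parts(3) m, of "Suc k"] \<sigma> \<tau>
        by (intro real_le_rsqrt) (simp add: pos_divide_le_eq)
      then show ?thesis unfolding bounded_iff by blast
    qed
    ultimately have "bounded (range (\<lambda>k. x (Suc k) - u) \<times> range (\<lambda>k. y (Suc k) - v) \<times> range (\<lambda>k. z (Suc k) - w))"
      by (intro bounded_Times)
    then have "bounded ((\<lambda>q. (u, v, w) + q) ` (range (\<lambda>k. x (Suc k) - u) \<times> range (\<lambda>k. y (Suc k) - v) \<times> range (\<lambda>k. z (Suc k) - w)))"
      by (rule bounded_translation)
    then show ?thesis by (rule bounded_subset) (force simp: image_iff)
  qed
  then obtain l r where r: "strict_mono r" and l: "(?p \<circ> r) \<longlonglongrightarrow> l"
    using bounded_imp_convergent_subsequence by blast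
  obtain u v w where uvw: "l = (u, v, w)" by (cases l)
  have lx: "(\<lambda>j. x (Suc (r j))) \<longlonglongrightarrow> u" and ly: "(\<lambda>j. y (Suc (r j))) \<longlonglongrightarrow> v" and lz: "(\<lambda>j. z (Suc (r j))) \<longlonglongrightarrow> w"
    using tendsto_fst[OF l] tendsto_fst[OF tendsto_snd[OF l]] tendsto_snd[OF tendsto_snd[OF l]]
    by (simp_all add: uvw o_def)
  have along: "(\<lambda>j. h (r j)) \<longlonglongrightarrow> t" if "h \<longlonglongrightarrow> t" for h :: "nat \<Rightarrow> 'q::topological_space" and t
    using LIMSEQ_subseq_LIMSEQ[OF that r] by (simp add: o_def)
  have ef_r: "(\<lambda>j. ef (r j)) \<longlonglongrightarrow> 0" by (rule along[OF ef0])
  have eg_r: "(\<lambda>j. eg (r j)) \<longlonglongrightarrow> 0" by (rule along[OF eg0])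
  have dx_r: "(\<lambda>j. dx (r j)) \<longlonglongrightarrow> 0" by (rule along[OF dx0])
  have dy_r: "(\<lambda>j. dy (r j)) \<longlonglongrightarrow> 0" by (rule along[OF dy0])
  have R_r: "(\<lambda>j. R (Suc (r j))) \<longlonglongrightarrow> 0" by (rule along[OF R0])
  note linPf = self_adjoint_linear[OF Pf] and lin\<Sigma>f = self_adjoint_linear[OF psd_self_adjoint[OF \<Sigma>f]]
    and linTg = self_adjoint_linear[OF pd_self_adjoint[OF Tg]] and linPg = self_adjoint_linear[OF Pg]
  have zk: "z k = z (Suc k) - (\<tau> * \<sigma>) *\<^sub>R R (Suc k)" for k using z_step[of k] by (simp add: R_def)
  have kkt: "kkt_point f g A B c u v w"
    unfolding kkt_point_def
  proof (intro conjI)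
    let ?s = "\<lambda>k. ef k - Pf (dx k) - A (z (Suc k) - (\<tau> * \<sigma>) *\<^sub>R R (Suc k) + \<sigma> *\<^sub>R (R (Suc k) - adjoint B (dy k)))"
    have "?s k \<in> subdiff f (x (Suc k))" for k
      using x_step[of k] by (simp add: residual_half_step zk[symmetric] dx_def)
    moreover have "(\<lambda>j. ?s (r j)) \<longlonglongrightarrow> 0 - Pf 0 - A (w - (\<tau> * \<sigma>) *\<^sub>R 0 + \<sigma> *\<^sub>R (0 - adjoint B 0))"
      by (intro tendsto_diff tendsto_add tendsto_scaleR tendsto_const ef_r lz R_r
          tendsto_linear[OF linPf dx_r] tendsto_linear[OF A] tendsto_linear[OF adjoint_linear[OF B] dy_r])
    then have "(\<lambda>j. ?s (r j)) \<longlonglongrightarrow> - A w"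
      by (simp add: linear_0[OF linPf] linear_0[OF adjoint_linear[OF B]])
    ultimately show "- A w \<in> subdiff f u"
      by (intro subdiff_graph_closed[OF f _ lx, of "\<lambda>j. ?s (r j)"])
    let ?t = "\<lambda>k. eg k - Pg (dy k) - B (z (Suc k) - (\<tau> * \<sigma>) *\<^sub>R R (Suc k) + \<sigma> *\<^sub>R R (Suc k))"
    have "?t k \<in> subdiff g (y (Suc k))" for k
      using y_step[of k] by (simp add: R_def[symmetric] zk[symmetric] dy_def)
    moreover have "(\<lambda>j. ?t (r j)) \<longlonglongrightarrow> 0 - Pg 0 - B (w - (\<tau> * \<sigma>) *\<^sub>R 0 + \<sigma> *\<^sub>R 0)"
      by (intro tendsto_diff tendsto_add tendsto_scaleR tendsto_const eg_r lz R_r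
          tendsto_linear[OF linPg dy_r] tendsto_linear[OF B])
    then have "(\<lambda>j. ?t (r j)) \<longlonglongrightarrow> - B w"
      by (simp add: linear_0[OF linPg])
    ultimately show "- B w \<in> subdiff g v"
      by (intro subdiff_graph_closed[OF g _ ly, of "\<lambda>j. ?t (r j)"])
    have "(\<lambda>j. R (Suc (r j))) \<longlonglongrightarrow> residual A B c u v"
      unfolding R_def residual_def
      by (intro tendsto_diff tendsto_add tendsto_const tendsto_linear[OF adjoint_linear[OF A] lx]
          tendsto_linear[OF adjoint_linear[OF B] ly])
    then show "residual A B c u v = 0" using R_r by (rule LIMSEQ_unique)
  qed
  have m0: "merit u v w \<longlonglongrightarrow> 0"
  proof -
    have "(\<lambda>j. merit u v w (Suc (r j))) \<longlonglongrightarrow> 0 + 0 + 0 + (norm (w - w))\<^sup>2 / (\<tau> * \<sigma>)"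
      unfolding merit_def using \<sigma> \<tau>
      by (intro tendsto_add tendsto_divide tendsto_power tendsto_norm tendsto_diff tendsto_const lz
          tendsto_sqnorm_op_diff[OF linPf lx] tendsto_sqnorm_op_diff[OF lin\<Sigma>f lx]
          tendsto_sqnorm_op_diff[OF linTg ly]) auto
    then have sub0: "(\<lambda>j. merit u v w (Suc (r j))) \<longlonglongrightarrow> 0" by simp
    obtain L where L: "merit u v w \<longlonglongrightarrow> L" using merit_conv[OF kkt] by (auto simp: convergent_def)
    have "L = 0" by (rule LIMSEQ_unique[OF along[OF LIMSEQ_Suc[OF L]] sub0])
    then show ?thesis using L by simp
  qed
  have "(\<lambda>k. 2 * (merit u v w (Suc k) + step_size k)) \<longlonglongrightarrow> 2 * (0 + 0)"
    by (intro tendsto_intros LIMSEQ_Suc[OF m0] D)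
  then have "(\<lambda>k. sqnorm_op (T_op \<sigma> A Pf \<Sigma>f) (x (Suc k) - u)) \<longlonglongrightarrow> 0"
    by (intro sqz[OF Tf0 Tf_error_le[OF kkt]]) simp
  then have "(\<lambda>k. x (Suc k) - u) \<longlonglongrightarrow> 0" by (rule pd_sqnorm_tendsto_zero[OF Tf])
  then have "(\<lambda>k. x (Suc k)) \<longlonglongrightarrow> u" by (rule LIM_zero_cancel)
  then have "x \<longlonglongrightarrow> u" by (rule LIMSEQ_imp_Suc)
  moreover have "(\<lambda>k. y k - v) \<longlonglongrightarrow> 0"
    by (rule pd_sqnorm_tendsto_zero[OF Tg], rule sqz[OF Tg_nonneg merit_parts(2) m0])
  then have "y \<longlonglongrightarrow> v" by (rule LIM_zero_cancel)
  moreover have "z \<longlonglongrightarrow> w"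
  proof -
    have "(\<lambda>k. (norm (z k - w))\<^sup>2 / (\<tau> * \<sigma>)) \<longlonglongrightarrow> 0"
      by (rule sqz[OF _ merit_parts(3) m0]) (use \<sigma> \<tau> in simp)
    then have "(\<lambda>k. (norm (z k - w))\<^sup>2 / (\<tau> * \<sigma>) * (\<tau> * \<sigma>)) \<longlonglongrightarrow> 0 * (\<tau> * \<sigma>)" by (intro tendsto_intros)
    then have "(\<lambda>k. (norm (z k - w))\<^sup>2) \<longlonglongrightarrow> 0" using \<sigma> \<tau> by simp
    then have "(\<lambda>k. norm (z k - w)) \<longlonglongrightarrow> 0"
      using tendsto_real_sqrt[of "\<lambda>k. (norm (z k - w))\<^sup>2" 0 sequentially] by simp
    then have "(\<lambda>k. z k - w) \<longlonglongrightarrow> 0" by (rule tendsto_norm_zero_cancel)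
    then show ?thesis by (rule LIM_zero_cancel)
  qed
  ultimately show thesis using that kkt by blast
qed

end

theorem theorem4p2:
  fixes f :: "'x::euclidean_space \<Rightarrow> ereal" and g :: "'y::euclidean_space \<Rightarrow> ereal"
    and A :: "'z::euclidean_space \<Rightarrow> 'x" and B :: "'z \<Rightarrow> 'y" and c :: 'z
    and \<Sigma>f Pf F :: "'x \<Rightarrow> 'x" and \<Sigma>g Pg G :: "'y \<Rightarrow> 'y"
    and \<sigma> \<tau> :: real and \<mu> \<nu> :: "nat \<Rightarrow> real"
    and x :: "nat \<Rightarrow> 'x" and y :: "nat \<Rightarrow> 'y" and z :: "nat \<Rightarrow> 'z"
  assumes "closed_proper_convex f" and "closed_proper_convex g"
    and "linear A" and "linear B"
    and "convexity_operator f \<Sigma>f" and "convexity_operator g \<Sigma>g"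
    and "assumption_A f g A B c"
    and "IEIDP_ADMM_C2 f g A B c \<sigma> \<tau> \<Sigma>f \<Sigma>g Pf Pg F G \<mu> \<nu> x y z"
    and "\<forall>k\<ge>1. max (\<mu> k) (\<nu> k) \<le> min 0.1 ((2 - \<tau>) / 4)"
    and "psd (\<lambda>u. Pf u + (3/8) *\<^sub>R \<Sigma>f u)" and "psd (\<lambda>v. Pg v + (3/8) *\<^sub>R \<Sigma>g v)"
    and "\<tau> \<in> {0<..<(1 + sqrt 5) / 2} \<or>
         (\<tau> \<in> {(1 + sqrt 5) / 2..<2} \<and>
          summable (\<lambda>k. 10 * \<sigma> / \<tau> * (norm (residual A B c (x k) (y k)))\<^sup>2
                        + sqnorm_op (T_op \<sigma> B Pg \<Sigma>g) (y (Suc k) - y k)))"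
  shows "(\<exists>xs ys. primal_solution f g A B c xs ys \<and> (\<lambda>k. (x k, y k)) \<longlonglongrightarrow> (xs, ys)) \<and>
         (\<exists>zs. dual_solution f g A B c zs \<and> z \<longlonglongrightarrow> zs)"
proof -
  note f = assms(1) and g = assms(2) and A = assms(3) and B = assms(4)
  note alg = assms(8)[unfolded IEIDP_ADMM_C2_def]
  let ?Tf = "T_op \<sigma> A Pf \<Sigma>f" and ?Tg = "T_op \<sigma> B Pg \<Sigma>g"
  define \<epsilon> where "\<epsilon> k = max (\<mu> (Suc k)) (\<nu> (Suc k))" for k
  have \<sigma>: "0 < \<sigma>" and \<tau>: "0 < \<tau>" and Pf: "self_adjoint Pf" and Pg: "self_adjoint Pg"
    and Tf: "pd ?Tf" and Tg: "pd ?Tg" and F: "pd F" and G: "pd G"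
    and FT: "loewner_le (inv F) ?Tf" and GT: "loewner_le (inv G) ?Tg"
    and \<epsilon>_sum: "summable \<epsilon>" and y_init: "y 0 \<in> edom g"
    using alg unfolding \<epsilon>_def by simp_all
  have \<mu>: "0 \<le> \<mu> (Suc k)" "0 \<le> \<nu> (Suc k)" for k using alg by simp_all
  have xs: "approx_minimizer F ?Tf (\<mu> (Suc k)) (x_subproblem f g A B c \<sigma> Pf (x k) (y k) (z k)) (x k) (x (Suc k))"
    and ys: "approx_minimizer G ?Tg (\<nu> (Suc k)) (y_subproblem f g A B c \<sigma> Pg (x (Suc k)) (y k) (z k)) (y k) (y (Suc k))"
    and zs: "z (Suc k) = z k + (\<tau> * \<sigma>) *\<^sub>R residual A B c (x (Suc k)) (y (Suc k))" for k
    using alg unfolding residual_def by blast+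
  have x_upd: "\<exists>e. norm_op F e \<le> \<mu> (Suc k) * norm_op ?Tf (x (Suc k) - x k) \<and>
      e - Pf (x (Suc k) - x k) - A (z k + \<sigma> *\<^sub>R residual A B c (x (Suc k)) (y k)) \<in> subdiff f (x (Suc k))"
    if yk: "y k \<in> edom g" for k
  proof -
    obtain b where b: "g (y k) = ereal b" by (rule closed_proper_convex_finite[OF g yk])
    have "x_subproblem f g A B c \<sigma> Pf (x k) (y k) (z k) = (\<lambda>v. f v + ereal (b
        + z k \<bullet> (adjoint A v + (adjoint B (y k) - c)) + \<sigma> / 2 * (norm (adjoint A v + (adjoint B (y k) - c)))\<^sup>2
        + 1 / 2 * sqnorm_op Pf (v - x k)))"
    proof
      show "x_subproblem f g A B c \<sigma> Pf (x k) (y k) (z k) v = f v + ereal (b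
          + z k \<bullet> (adjoint A v + (adjoint B (y k) - c)) + \<sigma> / 2 * (norm (adjoint A v + (adjoint B (y k) - c)))\<^sup>2
          + 1 / 2 * sqnorm_op Pf (v - x k))" for v
        unfolding x_subproblem_def aug_lagrangian_def b
        by (cases "f v") (auto simp: add_diff_eq)
    qed
    from block_update_subgradient[OF f A Pf this xs F] show ?thesis
      by (auto simp: residual_def add_diff_eq)
  qed
  have y_upd: "\<exists>e. norm_op G e \<le> \<nu> (Suc k) * norm_op ?Tg (y (Suc k) - y k) \<and>
      e - Pg (y (Suc k) - y k) - B (z k + \<sigma> *\<^sub>R residual A B c (x (Suc k)) (y (Suc k))) \<in> subdiff g (y (Suc k))"
    if xk: "x (Suc k) \<in> edom f" for k
  proof -
    obtain a where a: "f (x (Suc k)) = ereal a" by (rule closed_proper_convex_finite[OF f xk])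
    have rw: "adjoint A (x (Suc k)) + adjoint B v - c = adjoint B v + (adjoint A (x (Suc k)) - c)" for v
      by simp
    have "y_subproblem f g A B c \<sigma> Pg (x (Suc k)) (y k) (z k) = (\<lambda>v. g v + ereal (a
        + z k \<bullet> (adjoint B v + (adjoint A (x (Suc k)) - c))
        + \<sigma> / 2 * (norm (adjoint B v + (adjoint A (x (Suc k)) - c)))\<^sup>2
        + 1 / 2 * sqnorm_op Pg (v - y k)))"
    proof
      show "y_subproblem f g A B c \<sigma> Pg (x (Suc k)) (y k) (z k) v = g v + ereal (a
          + z k \<bullet> (adjoint B v + (adjoint A (x (Suc k)) - c))
          + \<sigma> / 2 * (norm (adjoint B v + (adjoint A (x (Suc k)) - c)))\<^sup>2
          + 1 / 2 * sqnorm_op Pg (v - y k))" for v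
        unfolding y_subproblem_def aug_lagrangian_def a rw
        by (cases "g v") auto
    qed
    from block_update_subgradient[OF g B Pg this ys G] show ?thesis
      by (metis residual_def rw)
  qed
  \<comment> \<open>a subproblem is proper only if the block that it holds fixed lies in its domain, so the two
    domain statements have to be propagated alternately\<close>
  have y_dom: "y k \<in> edom g" for k
  proof (induction k)
    case 0
    show ?case by (rule y_init)
  next
    case (Suc k)
    have "x (Suc k) \<in> edom f" using x_upd[OF Suc] subdiff_in_edom[OF f] by blast
    then show ?case using y_upd subdiff_in_edom[OF g] by blast
  qed
  have x_dom: "x (Suc k) \<in> edom f" for k using x_upd[OF y_dom] subdiff_in_edom[OF f] by blast
  obtain ef where ef: "\<And>k. norm_op F (ef k) \<le> \<mu> (Suc k) * norm_op ?Tf (x (Suc k) - x k)"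
    "\<And>k. ef k - Pf (x (Suc k) - x k) - A (z k + \<sigma> *\<^sub>R residual A B c (x (Suc k)) (y k)) \<in> subdiff f (x (Suc k))"
    using x_upd[OF y_dom] by metis
  obtain eg where eg: "\<And>k. norm_op G (eg k) \<le> \<nu> (Suc k) * norm_op ?Tg (y (Suc k) - y k)"
    "\<And>k. eg k - Pg (y (Suc k) - y k) - B (z k + \<sigma> *\<^sub>R residual A B c (x (Suc k)) (y (Suc k))) \<in> subdiff g (y (Suc k))"
    using y_upd[OF x_dom] by metis
  interpret inexact_admm f g A B c \<Sigma>f Pf \<Sigma>g Pg \<sigma> \<tau> x y z ef eg \<epsilon>
  proof (rule inexact_admm.intro)
    show "sqnorm_op \<Sigma>f (u - u') \<le> (s - s') \<bullet> (u - u')"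
      if "s \<in> subdiff f u" "s' \<in> subdiff f u'" for u u' s s'
      using assms(5) that subdiff_in_edom[OF f] unfolding convexity_operator_def by blast
    show "sqnorm_op \<Sigma>g (u - u') \<le> (s - s') \<bullet> (u - u')"
      if "s \<in> subdiff g u" "s' \<in> subdiff g u'" for u u' s s'
      using assms(6) that subdiff_in_edom[OF g] unfolding convexity_operator_def by blast
    show "psd \<Sigma>f" "psd \<Sigma>g" using assms(5,6) by (auto simp: convexity_operator_def)
    show "0 \<le> sqnorm_op Pf u + 3 / 8 * sqnorm_op \<Sigma>f u" for u
      using psd_sqnorm_nonneg[OF assms(10), of u] by (simp add: sqnorm_op_def inner_add_right)
    show "0 \<le> sqnorm_op Pg v + 3 / 8 * sqnorm_op \<Sigma>g v" for v
      using psd_sqnorm_nonneg[OF assms(11), of v] by (simp add: sqnorm_op_def inner_add_right)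
    show "0 \<le> \<epsilon> k" for k using \<mu>[of k] by (simp add: \<epsilon>_def le_max_iff_disj)
    note nonneg = psd_sqnorm_nonneg[OF pd_imp_psd[OF Tf]] psd_sqnorm_nonneg[OF pd_imp_psd[OF Tg]]
    show "2 * \<bar>ef k \<bullet> u\<bar> \<le> \<epsilon> k * (sqnorm_op ?Tf (x (Suc k) - x k) + sqnorm_op ?Tf u)" for k u
      by (rule order_trans[OF two_relative_error_le[OF F Tf FT ef(1) \<mu>(1)] mult_right_mono])
        (simp_all add: \<epsilon>_def nonneg add_nonneg_nonneg)
    show "2 * \<bar>eg k \<bullet> v\<bar> \<le> \<epsilon> k * (sqnorm_op ?Tg (y (Suc k) - y k) + sqnorm_op ?Tg v)" for k v
      by (rule order_trans[OF two_relative_error_le[OF G Tg GT eg(1) \<mu>(2)] mult_right_mono])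
        (simp_all add: \<epsilon>_def nonneg add_nonneg_nonneg)
  qed (fact f g A B Pf Pg Tf Tg \<sigma> \<tau> \<epsilon>_sum ef(2) eg(2) zs)+
  obtain u0 v0 w0 where kkt0: "kkt_point f g A B c u0 v0 w0"
    using kkt_point_exists[OF f g A B assms(7)] .
  have descent: "convergent (merit u v w) \<and> step_size \<longlonglongrightarrow> 0" if "kkt_point f g A B c u v w" for u v w
    using assms(12)
  proof
    assume "\<tau> \<in> {0<..<(1 + sqrt 5) / 2}"
    then show ?thesis using descent_small_dual_step[OF that] by simp
  next
    assume "\<tau> \<in> {(1 + sqrt 5) / 2..<2} \<and>
          summable (\<lambda>k. 10 * \<sigma> / \<tau> * (norm (residual A B c (x k) (y k)))\<^sup>2
                        + sqnorm_op (T_op \<sigma> B Pg \<Sigma>g) (y (Suc k) - y k))"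
    then show ?thesis using descent_large_dual_step[OF that] by (simp add: R_def dy_def)
  qed
  obtain u v w where "kkt_point f g A B c u v w" and lim: "x \<longlonglongrightarrow> u" "y \<longlonglongrightarrow> v" "z \<longlonglongrightarrow> w"
    using inexact_iterates_converge kkt0 descent by metis
  then have "primal_solution f g A B c u v" "dual_solution f g A B c w"
    using kkt_primal_solution[OF f g A B] kkt_dual_solution[OF f g A B] by blast+
  then show ?thesis using lim tendsto_Pair[OF lim(1,2)] by blast
qed

end
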